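(* Suppose $x=(10\log q)^B$ for some $B\ge 1$, with $x=q^{o(1)}$ as $q\to\infty$. Then $$\max_{\chi\neq\chi_0}\left|\sum_{n\le x}\chi(n)\right|\gg \frac{x^{\frac12+\frac{[B]}{2B}}}{(4\log x)^{[B]}}.$$ If, in addition, $q$ has fewer than $(\log q)^{B/(B+1)-\epsilon}$ distinct prime factors (for a fixed $\epsilon>0$), then $$\max_{\chi\neq\chi_0}\left|\sum_{n\le x}\chi(n)\right|\gg \frac{x}{(4\log x)^{[B]+1}}.$$
   Context: The maximum is over non-principal Dirichlet characters $\chi$ modulo $q$; $\chi_0$ is the principal character. $[B]$ denotes the integer part of $B$. Implied constants are absolute (possibly depending on $\epsilon$ in the second part). *)

theory Defs
  imports Complex_Main "HOL-Number_Theory.Number_Theory"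
begin

(* The modulus is assumed to be positive wherever this is used: for q = 0 the periodicity
   condition is void. *)
definition dirichlet_character :: "nat \<Rightarrow> (nat \<Rightarrow> complex) \<Rightarrow> bool" where
  "dirichlet_character q \<chi> \<longleftrightarrow>
     (\<forall>m n. \<chi> (m * n) = \<chi> m * \<chi> n) \<and>
     (\<forall>n. \<chi> (n + q) = \<chi> n) \<and>
     (\<forall>n. \<chi> n \<noteq> 0 \<longleftrightarrow> coprime n q)"

definition principal_character :: "nat \<Rightarrow> nat \<Rightarrow> complex" where
  "principal_character q n = (if coprime n q then 1 else 0)"

definition nonprincipal_characters :: "nat \<Rightarrow> (nat \<Rightarrow> complex) set" where
  "nonprincipal_characters q = {\<chi>. dirichlet_character q \<chi> \<and> \<chi> \<noteq> principal_character q}"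

definition character_sum :: "(nat \<Rightarrow> complex) \<Rightarrow> real \<Rightarrow> complex" where
  "character_sum \<chi> x = (\<Sum>n | 1 \<le> n \<and> real n \<le> x. \<chi> n)"

(* The set is finite for q > 0 (see finite_nonprincipal_characters); it is empty, and Max
   unspecified, for q = 1 and q = 2. *)
definition max_character_sum :: "nat \<Rightarrow> real \<Rightarrow> real" where
  "max_character_sum q x = Max ((\<lambda>\<chi>. cmod (character_sum \<chi> x)) ` nonprincipal_characters q)"

lemma dirichlet_character_principal:
  "dirichlet_character q (principal_character q)"
proof -
  have "coprime (n + q) q \<longleftrightarrow> coprime n q" for n
    by (metis coprime_iff_gcd_eq_1 gcd_add1)
  then show ?thesis
    by (auto simp: dirichlet_character_def principal_character_def)
qed

lemma dirichlet_character_mod: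
  assumes "dirichlet_character q \<chi>"
  shows "\<chi> (n mod q) = \<chi> n"
proof -
  have step: "\<chi> (m + k * q) = \<chi> m" for m k
  proof (induction k)
    case (Suc k)
    have "\<chi> (m + Suc k * q) = \<chi> ((m + k * q) + q)"
      by (simp add: algebra_simps)
    then show ?case
      using assms Suc by (simp only: dirichlet_character_def)
  qed simp
  show ?thesis
    using step[of "n mod q" "n div q"] by simp
qed

lemma dirichlet_character_power:
  assumes "dirichlet_character q \<chi>"
  shows "\<chi> (n ^ k) = \<chi> n ^ k"
proof (induction k)
  case 0
  have "\<chi> (1 * 1) = \<chi> 1 * \<chi> 1"
    using assms unfolding dirichlet_character_def by blast
  moreover have "\<chi> 1 \<noteq> 0"
    using assms unfolding dirichlet_character_def by (metis coprime_1_left)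
  ultimately have "\<chi> 1 = 1" by simp
  then show ?case by simp
next
  case (Suc k)
  then show ?case
    using assms by (simp add: dirichlet_character_def)
qed

lemma dirichlet_character_root_of_unity:
  assumes "dirichlet_character q \<chi>" and "coprime n q"
  shows "\<chi> n ^ totient q = 1"
proof -
  have "[n ^ totient q = 1] (mod q)"
    using assms(2) by (rule euler_theorem)
  then have "\<chi> (n ^ totient q) = \<chi> 1"
    using dirichlet_character_mod[OF assms(1)] unfolding cong_def by metis
  then show ?thesis
    using dirichlet_character_power[OF assms(1), of n] dirichlet_character_power[OF assms(1), of 1 0]
    by simp
qed

lemma finite_nonprincipal_characters:
  assumes "q > 0"
  shows "finite (nonprincipal_characters q)"
proof -
  let ?V = "insert 0 {z::complex. z ^ totient q = 1}"
  let ?F = "\<lambda>\<chi>::nat \<Rightarrow> complex. map \<chi> [0..<q]"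
  have "finite ?V"
    using assms finite_roots_unity[of "totient q"] by (simp add: Suc_le_eq)
  then have fin: "finite {xs. set xs \<subseteq> ?V \<and> length xs = q}"
    by (rule finite_lists_length_eq)
  have "\<chi> n \<in> ?V" if "\<chi> \<in> nonprincipal_characters q" for \<chi> n
  proof (cases "coprime n q")
    case True
    then show ?thesis
      using that dirichlet_character_root_of_unity[of q \<chi> n]
      by (simp add: nonprincipal_characters_def)
  next
    case False
    then have "\<chi> n = 0"
      using that unfolding nonprincipal_characters_def dirichlet_character_def by blast
    then show ?thesis by simp
  qed
  then have "?F ` nonprincipal_characters q \<subseteq> {xs. set xs \<subseteq> ?V \<and> length xs = q}"
    by (intro image_subsetI CollectI conjI) (simp_all add: image_subset_iff)
  then have "finite (?F ` nonprincipal_characters q)"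
    using fin by (rule finite_subset)
  moreover have "inj_on ?F (nonprincipal_characters q)"
  proof (rule inj_onI, rule ext)
    fix \<chi> \<psi> n
    assume *: "\<chi> \<in> nonprincipal_characters q" "\<psi> \<in> nonprincipal_characters q" "?F \<chi> = ?F \<psi>"
    then have "\<chi> (n mod q) = \<psi> (n mod q)"
      using assms by (simp only: map_eq_conv set_upt atLeastLessThan_iff) simp
    then show "\<chi> n = \<psi> n"
      using * dirichlet_character_mod[of q \<chi> n] dirichlet_character_mod[of q \<psi> n]
      by (simp add: nonprincipal_characters_def)
  qed
  ultimately show ?thesis
    by (rule finite_imageD)
qed

end

theory Submission
  imports
    "HOL-Real_Asymp.Real_Asymp"
    "HOL-Analysis.Harmonic_Numbers"
    "HOL-Analysis.Convex"
    "HOL-Combinatorics.Multiset_Permutations"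
    Defs
begin

text \<open>
  Take the \<open>2k\<close>-th moment of the character sums over all characters, with \<open>x ^ k\<close> slightly below \<open>q\<close>.
  By orthogonality it equals \<open>\<phi>(q)\<close> times the number of solutions of
  \<open>n\<^sub>1 \<cdots> n\<^sub>k = m\<^sub>1 \<cdots> m\<^sub>k\<close> in integers up to \<open>x\<close> coprime to \<open>q\<close>, and the principal character
  contributes at most half of it. Restrict the variables to numbers \<open>p\<^sub>1 \<cdots> p\<^sub>a p\<close> with
  \<open>p\<^sub>i \<le> w\<close> and \<open>p \<le> Y\<close> primes not dividing \<open>q\<close>, where \<open>w ^ a * Y \<le> x\<close>. The products of \<open>k\<close> such
  numbers take few values, since they are determined by multisets of primes, so the
  Cauchy--Schwarz inequality gives many solutions. With \<open>b = [B]\<close>, the first bound uses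
  \<open>w = 10 log q\<close> and \<open>a = b - 1\<close>, the second \<open>w = Y = x powr (1 / (b + 1))\<close> and \<open>a = b\<close>.
\<close>

(* HOL-Analysis uses the letter chi as a binder for vectors. *)
unbundle no vec_syntax

subsection \<open>Chebyshev's lower bound for the prime counting function\<close>

text \<open>Since \<open>B\<close> may grow with \<open>q\<close>, factorials and powers of
  \<open>a\<close> cannot be hidden in the constant. The loss from ordering the primes is offset by
  \<open>a * ln w \<le> ln x\<close>, which turns a count of at least \<open>w / (2 * ln w)\<close>
  primes into one of at least \<open>w * a / (2 * ln x)\<close>. Taking \<open>k\<close> near
  \<open>0.9 * ln q / ln x\<close> and \<open>w \<le> 10 * ln q\<close> makes \<open>k * a\<close>
  at least a fixed fraction of that bound, so each small prime gains more than
  \<open>(w / (4 * ln x)) ^ 2\<close> in the square of the maximum; this is the 4 of the theorem.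
  The single prime up to \<open>Y\<close> gains only a multiple of
  \<open>w * Y / (ln x) ^ 2\<close>, so \<open>w = Y\<close> would be best. Without a further
  hypothesis \<open>w\<close> cannot be much below \<open>10 * ln q\<close>, as \<open>q\<close> may
  be divisible by every prime up to about \<open>ln q\<close>. The 10 leaves room: of the primes up
  to \<open>y = 10 * ln q\<close>, at least \<open>0.65 * y / ln y\<close> in number, at most
  \<open>0.15 * y / ln y\<close> divide \<open>q\<close>, so the count stays above
  \<open>y / (2 * ln y)\<close>. Fewer prime factors of \<open>q\<close> allow a smaller
  \<open>w\<close>.\<close>

text \<open>The Leibniz triangle identity
  \<open>1 / (m * C(n, m)) = 1 / (m * C(n - 1, m)) - 1 / ((m + 1) * C(n, m + 1))\<close> drives the induction.\<close>

lemma leibniz_triangle_dvd: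
  fixes D :: nat
  assumes "\<And>i. 1 \<le> i \<Longrightarrow> i \<le> m + j \<Longrightarrow> i dvd D" and "m \<ge> 1"
  shows "m * ((m + j) choose m) dvd D"
  using assms
proof (induction j arbitrary: m)
  case 0
  then show ?case by simp
next
  case (Suc j)
  obtain u where u: "D = m * ((m + j) choose m) * u"
    using Suc.IH[of m] Suc.prems by (auto elim: dvdE)
  obtain v where v: "D = Suc m * ((Suc m + j) choose Suc m) * v"
    using Suc.IH[of "Suc m"] Suc.prems by (auto elim: dvdE)
  have 1: "Suc m * ((Suc m + j) choose Suc m) = Suc (m + j) * ((m + j) choose m)"
    using Suc_times_binomial[of m "m + j"] by simp
  have 2: "Suc j * ((m + Suc j) choose m) = Suc (m + j) * ((m + j) choose m)"
    using binomial_absorb_comp[of "m + Suc j" m] by simp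
  have "int (Suc j) * ((int u - int v) * int m * int ((m + Suc j) choose m))
      = (int u - int v) * int m * int (Suc j * ((m + Suc j) choose m))"
    by (simp add: algebra_simps)
  also have "\<dots> = int (Suc (m + j)) * int (m * ((m + j) choose m) * u)
      - int m * int (Suc m * ((Suc m + j) choose Suc m) * v)"
    unfolding 1 2 by (simp add: algebra_simps)
  also have "\<dots> = int (Suc j) * int D"
    unfolding u[symmetric] v[symmetric] by (simp add: algebra_simps)
  finally have "int D = (int u - int v) * int m * int ((m + Suc j) choose m)"
    by simp
  then have "int (m * ((m + Suc j) choose m)) dvd int D"
    by (simp add: mult.assoc)
  then show ?case by (simp only: of_nat_dvd_iff)
qed

text \<open>Nair's argument: \<open>D\<close> is the least common multiple of 1, ...,
  \<open>n\<close>, a product of prime powers that are each at most \<open>n\<close>, and it is a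
  multiple of \<open>m * (n choose m)\<close> by the preceding lemma.\<close>

lemma binomial_le_power_primes:
  assumes "1 \<le> m" and "m \<le> n"
  shows "n choose m \<le> n ^ card {p::nat. prime p \<and> p \<le> n}"
proof -
  define S where "S = {p::nat. prime p \<and> p \<le> n}"
  define e where "e p = Max (multiplicity p ` {1..n})" for p
  define D where "D = (\<Prod>p\<in>S. p ^ e p)"
  have fin: "finite S" unfolding S_def by simp
  have e_le: "p ^ e p \<le> n" if "p \<in> S" for p
  proof -
    have "e p \<in> multiplicity p ` {1..n}"
      unfolding e_def using assms by (intro Max_in) auto
    then obtain i where i: "i \<in> {1..n}" "e p = multiplicity p i" by auto
    have "p ^ e p dvd i" using i(2) by (simp add: multiplicity_dvd)
    then show ?thesis using i(1) dvd_imp_le[of "p ^ e p" i] by auto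
  qed
  have "i dvd D" if "1 \<le> i" "i \<le> n" for i
  proof -
    have "(\<Prod>p\<in>prime_factors i. p ^ multiplicity p i) dvd D"
      unfolding D_def
    proof (rule prod_dvd_prod_subset2[OF fin])
      show "prime_factors i \<subseteq> S"
        using that unfolding S_def by (auto simp: prime_factors_dvd dest!: dvd_imp_le)
      show "a ^ multiplicity a i dvd a ^ e a" if "a \<in> prime_factors i" for a
        unfolding e_def using \<open>1 \<le> i\<close> \<open>i \<le> n\<close> by (intro le_imp_power_dvd Max_ge) auto
    qed
    then show ?thesis using that by (simp flip: prime_factorization_nat)
  qed
  then have "m * (n choose m) dvd D"
    using leibniz_triangle_dvd[of m "n - m" D] assms by simp
  moreover have "D > 0"
    unfolding D_def S_def by (intro prod_pos) (auto dest: prime_gt_0_nat)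
  ultimately have "m * (n choose m) \<le> D" by (rule dvd_imp_le)
  moreover have "n choose m \<le> m * (n choose m)" using assms by simp
  moreover have "D \<le> n ^ card S"
    unfolding D_def using e_le by (subst prod_constant[symmetric]) (intro prod_mono, auto)
  ultimately show ?thesis unfolding S_def by linarith
qed

lemma finite_primes_le_real: "finite {p::nat. prime p \<and> real p \<le> t}"
  by (rule finite_subset[of _ "{..nat \<lfloor>t\<rfloor>}"]) (auto simp: le_nat_floor)

text \<open>Compares \<open>4 ^ n / (2 * n) \<le> (2 * n choose n)\<close> with the preceding bound,
  where \<open>2 * n\<close> is the largest even integer up to \<open>t\<close>. The 2/3 is a
  rational lower bound for \<open>ln 2\<close>, and \<open>t - 2\<close> accounts for the
  rounding.\<close>

lemma prime_counting_lower_bound: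
  assumes "t \<ge> 2"
  shows "real (card {p::nat. prime p \<and> real p \<le> t}) * ln t \<ge> (t - 2) * (2/3) - ln t"
proof -
  define n where "n = nat \<lfloor>t / 2\<rfloor>"
  have n: "real n \<le> t / 2" "t / 2 < real n + 1" "n \<ge> 1"
    using assms unfolding n_def by (linarith+)
  define P where "P = {p::nat. prime p \<and> p \<le> 2 * n}"
  define Q where "Q = {p::nat. prime p \<and> real p \<le> t}"
  have "P \<subseteq> Q"
  proof
    fix p assume "p \<in> P"
    then have "real p \<le> 2 * real n" "prime p" unfolding P_def by auto
    then show "p \<in> Q" unfolding Q_def using n by auto
  qed
  moreover have "finite Q" unfolding Q_def by (rule finite_primes_le_real)
  ultimately have c: "card P \<le> card Q" by (simp add: card_mono)
  have "4 ^ n / (2 * real n) \<le> real ((2 * n) choose n)"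
    using central_binomial_lower_bound n by simp
  also have "\<dots> \<le> real ((2 * n) ^ card P)"
    unfolding P_def using binomial_le_power_primes[of n "2 * n"] n by (simp only: of_nat_le_iff)
  finally have "4 ^ n \<le> (2 * real n) ^ card P * (2 * real n)"
    using n by (simp add: field_simps)
  also have "\<dots> \<le> t ^ card P * t"
    using n assms by (intro mult_mono power_mono) auto
  also have "\<dots> \<le> t ^ card Q * t"
    using c assms by (intro mult_right_mono power_increasing) auto
  finally have "ln (4 ^ n) \<le> ln (t ^ card Q * t)"
    using assms by (subst ln_le_cancel_iff) auto
  then have "real n * ln 4 \<le> real (card Q) * ln t + ln t"
    using assms by (simp add: ln_mult ln_realpow)
  moreover have "real n * ln 4 = 2 * real n * ln 2"
    using ln_realpow[of 2 2] by simp
  moreover have "(t - 2) * (2/3) \<le> (2 * real n) * ln 2"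
    using ln2_ge_two_thirds n assms by (intro mult_mono) auto
  ultimately show ?thesis unfolding Q_def[symmetric] by linarith
qed

text \<open>Any constant below 2/3 is available; 0.65 is 1/2 plus the 0.15 later lost to the primes
  dividing \<open>q\<close>.\<close>

lemma eventually_prime_counting:
  "\<forall>\<^sub>F t in at_top. real (card {p::nat. prime p \<and> real p \<le> t}) \<ge> 65/100 * t / ln t"
proof -
  have "\<forall>\<^sub>F t::real in at_top. (t - 2) * (2/3) - ln t \<ge> 65/100 * t"
    by real_asymp
  then show ?thesis
    using eventually_ge_at_top[of 2]
  proof eventually_elim
    case (elim t)
    then show ?case
      using prime_counting_lower_bound[of t] by (simp add: field_simps)
  qed
qed

subsection \<open>Orthogonality of Dirichlet characters\<close>

text \<open>A character of a subgroup of the units modulo \<open>q\<close>; \<open>H\<close> is the union of the residue classes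
  in the subgroup.\<close>

definition partial_character :: "nat \<Rightarrow> nat set \<Rightarrow> (nat \<Rightarrow> complex) \<Rightarrow> bool" where
  "partial_character q H f \<longleftrightarrow> 1 \<in> H \<and> (\<forall>n\<in>H. coprime n q) \<and>
     (\<forall>m\<in>H. \<forall>n\<in>H. m * n \<in> H \<and> f (m * n) = f m * f n) \<and> f 1 = 1 \<and>
     (\<forall>m\<in>H. \<forall>n. [m = n] (mod q) \<longrightarrow> n \<in> H \<and> f m = f n)"

lemma partial_character_power:
  assumes "partial_character q H f" "h \<in> H"
  shows "h ^ i \<in> H \<and> f (h ^ i) = f h ^ i"
  using assms by (induction i) (auto simp: partial_character_def)

lemma cong_inverse_power:
  assumes "coprime (h::nat) q" "q > 0"
  shows "[h ^ (totient q - 1) * h = 1] (mod q)"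
proof -
  have "totient q > 0" using assms by simp
  then have "h ^ (totient q - 1) * h = h ^ totient q"
    by (metis Suc_diff_1 power_Suc2)
  then show ?thesis using euler_theorem[OF assms(1)] by simp
qed

text \<open>A partial character is only required to have a domain closed under products and
  congruence; inverses are the powers \<open>h ^ (totient q - 1)\<close>.\<close>

lemma partial_character_cancel:
  assumes pc: "partial_character q H f" and "h \<in> H" "h * u \<in> H" "q > 0"
  shows "u \<in> H \<and> f (h * u) = f h * f u"
proof -
  let ?i = "h ^ (totient q - 1)"
  have "?i \<in> H" using partial_character_power[OF pc \<open>h \<in> H\<close>] by blast
  then have "?i * (h * u) \<in> H"
    using pc assms(3) by (auto simp: partial_character_def)
  moreover have "[?i * h * u = 1 * u] (mod q)"
    using cong_inverse_power[of h q] pc assms by (intro cong_mult) (auto simp: partial_character_def)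
  ultimately have "u \<in> H"
    using pc unfolding partial_character_def by (metis mult.assoc mult_1)
  then show ?thesis using pc \<open>h \<in> H\<close> by (auto simp: partial_character_def)
qed

text \<open>The exponent \<open>m\<close> is the order of \<open>g\<close> modulo \<open>H\<close>.\<close>

lemma partial_character_extend:
  assumes pc: "partial_character q H f" and q: "q > 0" and g: "coprime g q"
    and m: "m > 0" "g ^ m \<in> H" "\<And>i. 0 < i \<Longrightarrow> i < m \<Longrightarrow> g ^ i \<notin> H"
    and z: "z ^ m = f (g ^ m)"
  obtains H' f' where "partial_character q H' f'" "H \<subseteq> H'" "g \<in> H'"
    "\<And>h. h \<in> H \<Longrightarrow> f' h = f h" "f' g = z"
proof -
  \<comment> \<open>The pair \<open>(h, i)\<close> places \<open>n\<close> in the coset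
    \<open>H * g ^ i\<close>; natural exponents suffice because \<open>g\<close> has finite order
    modulo \<open>q\<close>. An \<open>n\<close> has many such pairs, so the choice in
    \<open>f'\<close> is meaningful only after \<open>uniq\<close>.\<close>
  define R where "R n h i \<longleftrightarrow> h \<in> H \<and> [n = h * g ^ i] (mod q)" for n h i
  define H' where "H' = {n. \<exists>h i. R n h i}"
  define f' where "f' n = (SOME w. \<exists>h i. R n h i \<and> w = f h * z ^ i)" for n
  \<comment> \<open>Minimality of \<open>m\<close> forces \<open>m\<close> to divide
    \<open>i\<close>, and then \<open>z ^ m = f (g ^ m)\<close> gives the value. This is the only
    obstruction to choosing \<open>z\<close> freely.\<close>
  have pow_in: "g ^ i \<in> H \<Longrightarrow> f (g ^ i) = z ^ i" for i
  proof -
    assume gi: "g ^ i \<in> H"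
    have eq: "g ^ i = (g ^ m) ^ (i div m) * g ^ (i mod m)"
      by (simp flip: power_mult power_add)
    have a: "(g ^ m) ^ (i div m) \<in> H \<and> f ((g ^ m) ^ (i div m)) = f (g ^ m) ^ (i div m)"
      using partial_character_power[OF pc m(2)] by blast
    then have "g ^ (i mod m) \<in> H"
      using partial_character_cancel[OF pc _ _ q] gi eq by metis
    then have "i mod m = 0" using m(3)[of "i mod m"] m(1) by auto
    then have i: "i = m * (i div m)" by (metis mult_div_mod_eq add_0_right)
    have "f (g ^ i) = f (g ^ m) ^ (i div m)" using a eq \<open>i mod m = 0\<close> by simp
    also have "\<dots> = z ^ (m * (i div m))" by (simp add: z[symmetric] power_mult)
    also have "\<dots> = z ^ i" using i by simp
    finally show ?thesis .
  qed
  \<comment> \<open>Cancelling \<open>g ^ i\<close> leaves \<open>h\<close> congruent to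
    \<open>h' * g ^ (j - i)\<close>, so \<open>g ^ (j - i)\<close> lies in \<open>H\<close> and
    \<open>pow_in\<close> applies.\<close>
  have uniq1: "f h * z ^ i = f h' * z ^ j" if "R n h i" "R n h' j" "i \<le> j" for n h i h' j
  proof -
    have "[h * g ^ i = h' * g ^ (j - i) * g ^ i] (mod q)"
      using that unfolding R_def
      by (metis cong_sym cong_trans le_add_diff_inverse2 mult.assoc power_add)
    then have "[h = h' * g ^ (j - i)] (mod q)"
      using cong_mult_rcancel_nat[of "g ^ i" q] g by auto
    moreover have "h \<in> H" "h' \<in> H" using that unfolding R_def by auto
    ultimately have in_H: "h' * g ^ (j - i) \<in> H" and eq: "f h = f (h' * g ^ (j - i))"
      using pc unfolding partial_character_def by blast+
    have "g ^ (j - i) \<in> H \<and> f (h' * g ^ (j - i)) = f h' * f (g ^ (j - i))"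
      using partial_character_cancel[OF pc \<open>h' \<in> H\<close> in_H q] .
    then have "f h = f h' * z ^ (j - i)" using pow_in eq by simp
    then show ?thesis using that(3) by (simp flip: power_add)
  qed
  have uniq: "f h * z ^ i = f h' * z ^ j" if "R n h i" "R n h' j" for n h i h' j
    using uniq1[of n h i h' j] uniq1[of n h' j h i] that by (cases "i \<le> j") auto
  have f': "f' n = f h * z ^ i" if "R n h i" for n h i
  proof -
    have "\<exists>h i. R n h i \<and> f' n = f h * z ^ i"
      unfolding f'_def by (rule someI_ex) (use that in blast)
    then show ?thesis using uniq that by metis
  qed
  have R_H: "R h h 0" if "h \<in> H" for h using that unfolding R_def by simp
  have one: "1 \<in> H" "f 1 = 1" using pc unfolding partial_character_def by auto
  have R_g: "R g 1 1" unfolding R_def using one by simp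
  have R_mult: "R (a * b) (h * h') (i + j)" if "R a h i" "R b h' j" for a b h h' i j
  proof -
    have "[a * b = (h * g ^ i) * (h' * g ^ j)] (mod q)"
      using that unfolding R_def by (intro cong_mult) auto
    then show ?thesis
      using that pc unfolding R_def partial_character_def by (simp add: power_add ac_simps)
  qed
  have R_cong: "R b h i" if "R a h i" "[a = b] (mod q)" for a b h i
    using that unfolding R_def by (meson cong_sym cong_trans)
  have R_coprime: "coprime a q" if "R a h i" for a h i
  proof -
    have "coprime (h * g ^ i) q"
      using that g pc unfolding R_def partial_character_def by auto
    then show ?thesis
      using that unfolding R_def by (meson cong_sym cong_imp_coprime)
  qed
  have "partial_character q H' f'"
    unfolding partial_character_def
  proof (intro conjI ballI allI impI)
    show "1 \<in> H'" using R_H one unfolding H'_def by blast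
    show "f' 1 = 1" using f'[OF R_H[OF one(1)]] one by simp
    show "coprime n q" if "n \<in> H'" for n using that R_coprime unfolding H'_def by blast
    fix a b assume "a \<in> H'"
    then obtain h i where a: "R a h i" unfolding H'_def by blast
    { assume "b \<in> H'"
      then obtain h' j where b: "R b h' j" unfolding H'_def by blast
      show "a * b \<in> H'" using R_mult[OF a b] unfolding H'_def by blast
      have "f (h * h') = f h * f h'"
        using a b pc unfolding R_def partial_character_def by blast
      then show "f' (a * b) = f' a * f' b"
        by (simp add: f'[OF R_mult[OF a b]] f'[OF a] f'[OF b] power_add) }
    { assume "[a = b] (mod q)"
      note b = R_cong[OF a this]
      show "b \<in> H'" using b unfolding H'_def by blast
      show "f' a = f' b" using f'[OF a] f'[OF b] by simp }
  qed
  moreover have "H \<subseteq> H'" "g \<in> H'" using R_H R_g unfolding H'_def by blast+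
  moreover have "f' h = f h" if "h \<in> H" for h using f'[OF R_H[OF that]] by simp
  moreover have "f' g = z" using f'[OF R_g] one by simp
  ultimately show ?thesis using that by blast
qed

lemma least_power_in:
  assumes "1 \<in> H" "\<And>a b. a \<in> H \<Longrightarrow> [a = b] (mod q) \<Longrightarrow> b \<in> H" "coprime g q" "q > (0::nat)"
  obtains m where "m > 0" "g ^ m \<in> H" "\<And>i. 0 < i \<Longrightarrow> i < m \<Longrightarrow> g ^ i \<notin> H"
proof -
  have "g ^ totient q \<in> H"
    using assms(1) assms(2)[of 1] euler_theorem[OF assms(3)] by (meson cong_sym)
  moreover have "totient q > 0" using assms by simp
  ultimately have ex: "\<exists>m. m > 0 \<and> g ^ m \<in> H" by blast
  show ?thesis
    by (rule that[of "LEAST m. m > 0 \<and> g ^ m \<in> H"])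
      (use LeastI_ex[OF ex] not_less_Least in blast)+
qed

lemma complex_root_exists:
  assumes "m > 0"
  obtains z :: complex where "z ^ m = w"
proof (cases "w = 0")
  case True
  then show ?thesis using that[of 0] assms by simp
next
  case False
  have "card {z. z ^ m = w} = m" using card_nth_roots[OF False assms] .
  then have "{z. z ^ m = w} \<noteq> {}" using assms by (metis card.empty less_numeral_extra(3))
  then show ?thesis using that by blast
qed

text \<open>Adjoin one reduced residue at a time, with any complex root of \<open>f (g ^ m)\<close>
  as its value, until \<open>H\<close> contains everything coprime to \<open>q\<close>; then extend
  by 0. The induction measure is the number of reduced residues still outside
  \<open>H\<close>.\<close>

lemma partial_character_complete:
  assumes "partial_character q H f" "q > 0"
  shows "\<exists>\<chi>. dirichlet_character q \<chi> \<and> (\<forall>n\<in>H. \<chi> n = f n)"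
  using assms
proof (induction "card (totatives q - H)" arbitrary: H f rule: less_induct)
  case less
  note pc = less.prems(1)
  show ?case
  proof (cases "\<exists>g. coprime g q \<and> g \<notin> H")
    case False
    define \<chi> where "\<chi> n = (if coprime n q then f n else 0)" for n
    have H: "n \<in> H \<longleftrightarrow> coprime n q" for n
      using False pc unfolding partial_character_def by blast
    have "f n \<noteq> 0" if "coprime n q" for n
    proof -
      have "n ^ (totient q - 1) \<in> H" using H that by simp
      moreover have "[n ^ (totient q - 1) * n = 1] (mod q)"
        using cong_inverse_power that \<open>q > 0\<close> by simp
      ultimately have "f (n ^ (totient q - 1)) * f n = 1"
        using pc H that unfolding partial_character_def by metis
      then show ?thesis by auto
    qed
    moreover have "f (n + q) = f n" if "coprime n q" for n
    proof -
      have "[n = n + q] (mod q)" by (simp add: cong_def)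
      then show ?thesis using pc H that unfolding partial_character_def by metis
    qed
    moreover have "coprime (n + q) q \<longleftrightarrow> coprime n q" for n
      by (metis coprime_iff_gcd_eq_1 gcd_add1)
    moreover have "f (a * b) = f a * f b" if "coprime a q" "coprime b q" for a b
      using pc H that unfolding partial_character_def by blast
    ultimately have "dirichlet_character q \<chi>"
      unfolding dirichlet_character_def \<chi>_def by auto
    moreover have "\<forall>n\<in>H. \<chi> n = f n" unfolding \<chi>_def using H by simp
    ultimately show ?thesis by blast
  next
    case True
    then obtain g where g: "coprime g q" "g \<notin> H" by blast
    obtain m where m: "m > 0" "g ^ m \<in> H" "\<And>i. 0 < i \<Longrightarrow> i < m \<Longrightarrow> g ^ i \<notin> H"
    proof (rule least_power_in[of H q g])
      show "1 \<in> H" "\<And>a b. a \<in> H \<Longrightarrow> [a = b] (mod q) \<Longrightarrow> b \<in> H"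
        using pc unfolding partial_character_def by blast+
    qed (use g \<open>q > 0\<close> in auto)
    obtain z where z: "z ^ m = f (g ^ m)" using complex_root_exists[OF m(1)] .
    obtain H' f' where ext: "partial_character q H' f'" "H \<subseteq> H'" "g \<in> H'"
      "\<And>h. h \<in> H \<Longrightarrow> f' h = f h"
      using partial_character_extend[OF pc \<open>q > 0\<close> g(1) m z] by metis
    have q1: "q > 1"
    proof (rule ccontr)
      assume "\<not> q > 1"
      then have "q = 1" using \<open>q > 0\<close> by simp
      then have "[1 = g] (mod q)" by (simp add: cong_def)
      then show False using pc g unfolding partial_character_def by blast
    qed
    \<comment> \<open>The measure only sees residues in \<open>totatives q\<close>, so the
      representative \<open>g mod q\<close> has to be the element that leaves the
      difference.\<close>
    have gm: "[g = g mod q] (mod q)" by (simp add: cong_def)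
    have "coprime (g mod q) q" using g q1 by (simp add: coprime_mod_left_iff)
    moreover from this have "g mod q \<noteq> 0" using q1 by (intro notI) simp
    ultimately have gmt: "g mod q \<in> totatives q"
      using q1 by (auto simp: in_totatives_iff intro: less_imp_le)
    have "g mod q \<notin> H"
      using g pc gm unfolding partial_character_def by (meson cong_sym)
    moreover have "g mod q \<in> H'"
      using ext gm unfolding partial_character_def by meson
    ultimately have "totatives q - H' \<subset> totatives q - H" using gmt ext(2) by blast
    then have "card (totatives q - H') < card (totatives q - H)"
      by (intro psubset_card_mono) auto
    from less.hyps[OF this ext(1) \<open>q > 0\<close>] show ?thesis using ext by (metis subsetD)
  qed
qed

text \<open>Start from the trivial character on the residue class of 1. There the order
  \<open>m\<close> of \<open>g\<close> is at least 2, so some \<open>z\<close> with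
  \<open>z ^ m = 1\<close> and \<open>z \<noteq> 1\<close> is a permitted value at
  \<open>g\<close>.\<close>

lemma separating_character:
  assumes "q > 0" "coprime g q" "\<not> [g = 1] (mod q)"
  obtains \<psi> where "dirichlet_character q \<psi>" "\<psi> g \<noteq> 1"
proof -
  define H where "H = {n. [n = 1] (mod q)}"
  have pc: "partial_character q H (\<lambda>_. 1)"
    unfolding partial_character_def H_def
  proof (intro conjI ballI allI impI)
    show "coprime n q" if "n \<in> {n. [n = 1] (mod q)}" for n
      using that by (auto intro: cong_imp_coprime[OF cong_sym])
    show "a * b \<in> {n. [n = 1] (mod q)}" if "a \<in> {n. [n = 1] (mod q)}" "b \<in> {n. [n = 1] (mod q)}" for a b
      using that cong_mult[of a 1 q b 1] by simp
    show "b \<in> {n. [n = 1] (mod q)}" if "a \<in> {n. [n = 1] (mod q)}" "[a = b] (mod q)" for a b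
      using that cong_trans[OF cong_sym] by blast
  qed auto
  obtain m where m: "m > 0" "g ^ m \<in> H" "\<And>i. 0 < i \<Longrightarrow> i < m \<Longrightarrow> g ^ i \<notin> H"
    by (rule least_power_in[of H q g]) 
      (use pc assms in \<open>auto simp: partial_character_def\<close>)
  have "m \<noteq> 1" using m(2) assms(3) unfolding H_def by auto
  then have "m \<ge> 2" using m(1) by simp
  have "card {z::complex. z ^ m = 1} = m" using card_roots_unity_eq[OF m(1)] .
  then have "\<not> {z::complex. z ^ m = 1} \<subseteq> {1}"
    using \<open>m \<ge> 2\<close> by (metis card_mono finite.emptyI finite.insertI card.empty card_insert_disjoint
        empty_iff not_less_eq_eq numeral_2_eq_2 One_nat_def)
  then obtain z :: complex where z: "z ^ m = 1" "z \<noteq> 1" by auto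
  obtain H' f' where ext: "partial_character q H' f'" "g \<in> H'" "f' g = z"
    using partial_character_extend[OF pc assms(1,2) m, of z] z by metis
  show ?thesis
    using partial_character_complete[OF ext(1) assms(1)] ext(2,3) z that by auto
qed

section \<open>Orthogonality relations and the number of characters\<close>

lemma dirichlet_character_one:
  assumes "dirichlet_character q \<chi>"
  shows "\<chi> 1 = 1"
  using dirichlet_character_power[OF assms, of 1 0] by simp

lemma dirichlet_character_cong:
  assumes "dirichlet_character q \<chi>" "[a = b] (mod q)"
  shows "\<chi> a = \<chi> b"
  using dirichlet_character_mod[OF assms(1)] assms(2) unfolding cong_def by metis

lemma finite_dirichlet_characters:
  assumes "q > 0"
  shows "finite {\<chi>. dirichlet_character q \<chi>}"
proof (rule finite_subset)
  show "{\<chi>. dirichlet_character q \<chi>} \<subseteq> insert (principal_character q) (nonprincipal_characters q)"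
    unfolding nonprincipal_characters_def by auto
qed (use finite_nonprincipal_characters[OF assms] in simp)

lemma dirichlet_character_mult:
  assumes "dirichlet_character q \<chi>" "dirichlet_character q \<psi>"
  shows "dirichlet_character q (\<lambda>n. \<chi> n * \<psi> n)"
  using assms unfolding dirichlet_character_def by auto

lemma norm_dirichlet_character:
  assumes "dirichlet_character q \<chi>" "coprime n q" "q > 0"
  shows "cmod (\<chi> n) = 1"
proof -
  have "cmod (\<chi> n) ^ totient q = 1"
    using dirichlet_character_root_of_unity[OF assms(1,2)] by (metis norm_one norm_power)
  then show ?thesis
    using assms(3) power_eq_imp_eq_base[of "cmod (\<chi> n)" "totient q" 1] by simp
qed

lemma dirichlet_character_cnj:
  assumes "dirichlet_character q \<chi>"
  shows "dirichlet_character q (\<lambda>n. cnj (\<chi> n))"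
  using assms unfolding dirichlet_character_def by auto

text \<open>Multiplication by a separating character \<psi> permutes the characters, so the sum
  equals \<open>\<psi> g\<close> times itself.\<close>

lemma sum_characters_eq_0:
  assumes "q > 0" "coprime g q" "\<not> [g = 1] (mod q)"
  shows "(\<Sum>\<chi> | dirichlet_character q \<chi>. \<chi> g) = 0"
proof -
  obtain \<psi> where \<psi>: "dirichlet_character q \<psi>" "\<psi> g \<noteq> 1"
    using separating_character[OF assms] .
  let ?X = "{\<chi>. dirichlet_character q \<chi>}"
  \<comment> \<open>Off the units \<open>\<psi> n * cnj (\<psi> n)\<close> is 0 rather than 1, but
    there \<open>\<chi> n\<close> is 0 as well.\<close>
  have inv: "\<psi> n * (cnj (\<psi> n) * \<chi> n) = \<chi> n" "cnj (\<psi> n) * (\<psi> n * \<chi> n) = \<chi> n"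
    if "dirichlet_character q \<chi>" for \<chi> n
  proof -
    have *: "\<psi> n * cnj (\<psi> n) * \<chi> n = \<chi> n"
    proof (cases "coprime n q")
      case True
      then show ?thesis
        using norm_dirichlet_character[OF \<psi>(1) _ assms(1), of n]
        by (simp add: complex_norm_square[symmetric])
    next
      case False
      then show ?thesis using that unfolding dirichlet_character_def by auto
    qed
    show "\<psi> n * (cnj (\<psi> n) * \<chi> n) = \<chi> n" using * by (simp add: mult.assoc)
    show "cnj (\<psi> n) * (\<psi> n * \<chi> n) = \<chi> n" using * by (simp add: ac_simps)
  qed
  have "(\<Sum>\<chi>\<in>?X. \<chi> g) = (\<Sum>\<chi>\<in>?X. \<psi> g * \<chi> g)"
    by (rule sum.reindex_bij_witness[of _ "\<lambda>\<chi> n. \<psi> n * \<chi> n" "\<lambda>\<chi> n. cnj (\<psi> n) * \<chi> n"])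
      (auto simp: inv intro!: dirichlet_character_mult dirichlet_character_cnj \<psi> assms)
  also have "\<dots> = \<psi> g * (\<Sum>\<chi>\<in>?X. \<chi> g)" by (simp add: sum_distrib_left)
  finally show ?thesis using \<psi>(2) by simp
qed

lemma sum_totatives_nonprincipal:
  assumes "q > 1" "dirichlet_character q \<chi>" "\<chi> \<noteq> principal_character q"
  shows "(\<Sum>n\<in>totatives q. \<chi> n) = 0"
proof -
  obtain h where h: "coprime h q" "\<chi> h \<noteq> 1"
  proof -
    obtain h where "\<chi> h \<noteq> principal_character q h" using assms(3) by blast
    then have "coprime h q \<and> \<chi> h \<noteq> 1"
      using assms(2) unfolding principal_character_def dirichlet_character_def
      by (metis)
    then show ?thesis using that by blast
  qed
  have inj: "inj_on (\<lambda>n. (h * n) mod q) (totatives q)"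
  proof (rule inj_onI)
    fix a b assume ab: "a \<in> totatives q" "b \<in> totatives q" "(h * a) mod q = (h * b) mod q"
    then have "[a = b] (mod q)"
      using h cong_mult_lcancel_nat[of h q a b] by (auto simp: cong_def)
    moreover have "a < q" "b < q" using ab assms(1) totatives_less by auto
    ultimately show "a = b" by (simp add: cong_def)
  qed
  have "(\<lambda>n. (h * n) mod q) ` totatives q \<subseteq> totatives q"
  proof safe
    fix n assume "n \<in> totatives q"
    then have c: "coprime ((h * n) mod q) q"
      using h assms(1) by (simp add: in_totatives_iff coprime_mod_left_iff)
    moreover have "(h * n) mod q \<noteq> 0" using c assms(1) by (intro notI) simp
    ultimately show "(h * n) mod q \<in> totatives q"
      using assms(1) by (auto simp: in_totatives_iff intro: less_imp_le)
  qed
  then have img: "(\<lambda>n. (h * n) mod q) ` totatives q = totatives q"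
    using inj by (intro endo_inj_surj) auto
  have "(\<Sum>n\<in>totatives q. \<chi> n) = (\<Sum>n\<in>(\<lambda>n. (h * n) mod q) ` totatives q. \<chi> n)"
    by (simp only: img)
  also have "\<dots> = (\<Sum>n\<in>totatives q. \<chi> ((h * n) mod q))"
    using inj by (subst sum.reindex) auto
  also have "\<dots> = (\<Sum>n\<in>totatives q. \<chi> h * \<chi> n)"
    using dirichlet_character_mod[OF assms(2)] assms(2)
    by (simp add: dirichlet_character_def)
  also have "\<dots> = \<chi> h * (\<Sum>n\<in>totatives q. \<chi> n)" by (simp add: sum_distrib_left)
  finally show ?thesis using h(2) by simp
qed

text \<open>Evaluate the double sum of \<open>\<chi> n\<close> over characters and reduced residues
  in both orders: only \<open>n = 1\<close> survives in one, only the principal character in the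
  other.\<close>

lemma card_dirichlet_characters:
  assumes "q > 1"
  shows "card {\<chi>. dirichlet_character q \<chi>} = totient q"
proof -
  let ?X = "{\<chi>. dirichlet_character q \<chi>}"
  have fin: "finite ?X" using finite_dirichlet_characters assms by simp
  have "(\<Sum>\<chi>\<in>?X. \<Sum>n\<in>totatives q. \<chi> n) = (\<Sum>n\<in>totatives q. \<Sum>\<chi>\<in>?X. \<chi> n)"
    by (rule sum.swap)
  also have "\<dots> = (\<Sum>n\<in>totatives q. if n = 1 then of_nat (card ?X) else 0)"
  proof (rule sum.cong[OF refl])
    fix n assume n: "n \<in> totatives q"
    then have "n < q" using totatives_less assms by auto
    then have "n = 1" if "[n = 1] (mod q)"
      using that assms by (simp add: cong_def)
    moreover have "(\<Sum>\<chi>\<in>?X. \<chi> 1) = (\<Sum>\<chi>\<in>?X. 1)"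
      by (intro sum.cong refl) (auto dest: dirichlet_character_one)
    ultimately show "(\<Sum>\<chi>\<in>?X. \<chi> n) = (if n = 1 then of_nat (card ?X) else 0)"
      using sum_characters_eq_0[of q n] assms n
      by (auto simp: in_totatives_iff)
  qed
  also have "\<dots> = of_nat (card ?X)"
    using assms by (simp add: sum.delta in_totatives_iff)
  also have "(\<Sum>\<chi>\<in>?X. \<Sum>n\<in>totatives q. \<chi> n) =
      (\<Sum>\<chi>\<in>?X. if \<chi> = principal_character q then of_nat (totient q) else 0)"
  proof (rule sum.cong[OF refl])
    fix \<chi> assume "\<chi> \<in> ?X"
    moreover have "(\<Sum>n\<in>totatives q. principal_character q n) = of_nat (totient q)"
      by (simp add: principal_character_def totient_def in_totatives_iff)
    ultimately show "(\<Sum>n\<in>totatives q. \<chi> n) = (if \<chi> = principal_character q then of_nat (totient q) else 0)"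
      using sum_totatives_nonprincipal[OF assms] by auto
  qed
  also have "\<dots> = of_nat (totient q)"
    using fin dirichlet_character_principal by (simp add: sum.delta)
  finally show ?thesis by (metis of_nat_eq_iff)
qed

lemma character_orthogonality:
  assumes "q > 1" "coprime a q" "coprime b q"
  shows "(\<Sum>\<chi> | dirichlet_character q \<chi>. \<chi> a * cnj (\<chi> b)) =
         (if [a = b] (mod q) then of_nat (totient q) else 0)"
proof -
  define g where "g = b ^ (totient q - 1) * a"
  have q: "q > 0" using assms by simp
  have bi: "[b ^ (totient q - 1) * b = 1] (mod q)"
    using cong_inverse_power assms q by blast
  have g: "coprime g q" using assms unfolding g_def by simp
  have eq: "\<chi> a * cnj (\<chi> b) = \<chi> g" if \<chi>: "dirichlet_character q \<chi>" for \<chi>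
  proof -
    have "\<chi> (b ^ (totient q - 1)) * \<chi> b = 1"
      using dirichlet_character_cong[OF \<chi> bi] dirichlet_character_one[OF \<chi>] \<chi>
      unfolding dirichlet_character_def by simp
    moreover have "cnj (\<chi> b) * \<chi> b = 1"
      using norm_dirichlet_character[OF \<chi> assms(3) q]
      by (simp add: mult.commute complex_norm_square[symmetric])
    ultimately have "cnj (\<chi> b) = \<chi> (b ^ (totient q - 1))"
      by (metis mult_cancel_right mult_zero_right zero_neq_one)
    then show ?thesis using \<chi> unfolding g_def dirichlet_character_def by simp
  qed
  have iff: "[g = 1] (mod q) \<longleftrightarrow> [a = b] (mod q)"
  proof
    assume "[a = b] (mod q)"
    then have "[g = b ^ (totient q - 1) * b] (mod q)"
      unfolding g_def by (intro cong_mult) auto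
    then show "[g = 1] (mod q)" using bi by (rule cong_trans)
  next
    assume *: "[g = 1] (mod q)"
    have "[b ^ (totient q - 1) * a = b ^ (totient q - 1) * b] (mod q)"
      using * bi unfolding g_def by (meson cong_sym cong_trans)
    then show "[a = b] (mod q)"
      using cong_mult_lcancel_nat[of "b ^ (totient q - 1)" q a b] assms by auto
  qed
  have "(\<Sum>\<chi> | dirichlet_character q \<chi>. \<chi> a * cnj (\<chi> b)) = (\<Sum>\<chi> | dirichlet_character q \<chi>. \<chi> g)"
    using eq by simp
  also have "\<dots> = (if [a = b] (mod q) then of_nat (totient q) else 0)"
  proof (cases "[a = b] (mod q)")
    case True
    then have "[g = 1] (mod q)" using iff by simp
    then have "\<chi> g = 1" if "dirichlet_character q \<chi>" for \<chi>
      using dirichlet_character_cong[OF that, of g 1] dirichlet_character_one[OF that] by simp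
    then have "(\<Sum>\<chi> | dirichlet_character q \<chi>. \<chi> g) = (\<Sum>\<chi> | dirichlet_character q \<chi>. 1)"
      by (intro sum.cong refl) blast
    then show ?thesis using True card_dirichlet_characters[OF assms(1)] by simp
  next
    case False
    then show ?thesis using sum_characters_eq_0[OF q g] iff by simp
  qed
  finally show ?thesis .
qed

subsection \<open>High moments of character sums\<close>

definition lists_of_length :: "'a set \<Rightarrow> nat \<Rightarrow> 'a list set" where
  "lists_of_length A k = {u. set u \<subseteq> A \<and> length u = k}"

definition mult_energy :: "nat set \<Rightarrow> nat \<Rightarrow> nat" where
  "mult_energy A k =
     card {(u, v). u \<in> lists_of_length A k \<and> v \<in> lists_of_length A k \<and> prod_list u = prod_list v}"

lemma finite_lists_of_length [simp]: "finite A \<Longrightarrow> finite (lists_of_length A k)"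
  unfolding lists_of_length_def by (rule finite_lists_length_eq)

lemma card_lists_of_length: "finite A \<Longrightarrow> card (lists_of_length A k) = card A ^ k"
  unfolding lists_of_length_def by (rule card_lists_length_eq)

lemma character_sum_power:
  assumes "dirichlet_character q \<chi>"
  shows "(\<Sum>n\<in>A. \<chi> n) ^ k = (\<Sum>u\<in>lists_of_length A k. \<chi> (prod_list u))"
proof (induction k)
  case 0
  have "lists_of_length A 0 = {[]}" unfolding lists_of_length_def by auto
  then show ?case using dirichlet_character_one[OF assms] by simp
next
  case (Suc k)
  have "(\<Sum>u\<in>lists_of_length A (Suc k). \<chi> (prod_list u))
      = (\<Sum>(u, n)\<in>lists_of_length A k \<times> A. \<chi> (prod_list (n # u)))"
    unfolding lists_of_length_def lists_length_Suc_eq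
    by (subst sum.reindex) (auto simp: inj_on_def case_prod_unfold)
  also have "\<dots> = (\<Sum>u\<in>lists_of_length A k. \<Sum>n\<in>A. \<chi> n * \<chi> (prod_list u))"
    using assms by (simp add: sum.cartesian_product dirichlet_character_def)
  also have "\<dots> = (\<Sum>n\<in>A. \<chi> n) * (\<Sum>u\<in>lists_of_length A k. \<chi> (prod_list u))"
    by (subst sum.swap) (simp add: sum_product)
  finally show ?case using Suc by simp
qed

text \<open>Cauchy-Schwarz for the fibre sizes \<open>c y\<close>: their sum is
  \<open>card L\<close>, and the sum of their squares counts the colliding pairs.\<close>

lemma card_square_le_collisions:
  assumes "finite L"
  shows "(card L)\<^sup>2 \<le> card (f ` L) * card {(u, v). u \<in> L \<and> v \<in> L \<and> f u = f v}"
proof -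
  define c where "c y = card {u \<in> L. f u = y}" for y
  have L: "card L = (\<Sum>y\<in>f ` L. c y)"
    using sum.image_gen[OF assms, of "\<lambda>_. 1::nat" f] unfolding c_def by simp
  have "{(u, v). u \<in> L \<and> v \<in> L \<and> f u = f v} = (\<Union>y\<in>f ` L. {u \<in> L. f u = y} \<times> {u \<in> L. f u = y})"
    by auto
  also have "card \<dots> = (\<Sum>y\<in>f ` L. card ({u \<in> L. f u = y} \<times> {u \<in> L. f u = y}))"
    using assms by (intro card_UN_disjoint) auto
  also have "\<dots> = (\<Sum>y\<in>f ` L. (c y)\<^sup>2)"
    unfolding c_def by (simp add: card_cartesian_product power2_eq_square)
  finally have E: "card {(u, v). u \<in> L \<and> v \<in> L \<and> f u = f v} = (\<Sum>y\<in>f ` L. (c y)\<^sup>2)" .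
  have "(\<Sum>y\<in>f ` L. 1 * real (c y))\<^sup>2 \<le> (\<Sum>y\<in>f ` L. 1\<^sup>2) * (\<Sum>y\<in>f ` L. (real (c y))\<^sup>2)"
    by (rule Cauchy_Schwarz_ineq_sum)
  then have "real ((card L)\<^sup>2) \<le> real (card (f ` L) * card {(u, v). u \<in> L \<and> v \<in> L \<and> f u = f v})"
    unfolding E unfolding L by simp
  then show ?thesis by (simp only: of_nat_le_iff)
qed

text \<open>Used twice: with \<open>A' = A\<close> to limit the share of the principal character,
  and with \<open>A'\<close> a set of products of primes to produce many solutions.\<close>

lemma mult_energy_lower:
  assumes "finite A" "A' \<subseteq> A"
  shows "card A' ^ (2 * k) \<le> card (prod_list ` lists_of_length A' k) * mult_energy A k"
proof -
  have fin: "finite A'" using assms finite_subset by blast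
  have sub: "lists_of_length A' k \<subseteq> lists_of_length A k"
    using assms unfolding lists_of_length_def by auto
  have "card A' ^ (2 * k) = (card (lists_of_length A' k))\<^sup>2"
    using fin by (simp add: card_lists_of_length power_mult mult.commute flip: power_mult)
  also have "\<dots> \<le> card (prod_list ` lists_of_length A' k) *
      card {(u, v). u \<in> lists_of_length A' k \<and> v \<in> lists_of_length A' k \<and> prod_list u = prod_list v}"
    using fin by (intro card_square_le_collisions) simp
  also have "\<dots> \<le> card (prod_list ` lists_of_length A' k) * mult_energy A k"
    unfolding mult_energy_def
  proof (intro mult_left_mono card_mono)
    show "finite {(u, v). u \<in> lists_of_length A k \<and> v \<in> lists_of_length A k \<and> prod_list u = prod_list v}"
      by (rule finite_subset[of _ "lists_of_length A k \<times> lists_of_length A k"]) (use assms in auto)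
  qed (use sub in auto)
  finally show ?thesis .
qed

lemma coprime_prod_list:
  "(\<And>n. n \<in> set u \<Longrightarrow> coprime n (q::nat)) \<Longrightarrow> coprime (prod_list u) q"
  by (induction u) auto

text \<open>Orthogonality detects congruence modulo \<open>q\<close>; as all products stay below
  \<open>q\<close>, congruent products are equal.\<close>

lemma sum_moments_eq_energy:
  assumes q: "q > 1" and "finite A" and cop: "\<And>n. n \<in> A \<Longrightarrow> coprime n q"
    and less: "\<And>u. u \<in> lists_of_length A k \<Longrightarrow> prod_list u < q"
  shows "(\<Sum>\<chi> | dirichlet_character q \<chi>. cmod (\<Sum>n\<in>A. \<chi> n) ^ (2 * k)) = totient q * mult_energy A k"
proof -
  let ?X = "{\<chi>. dirichlet_character q \<chi>}" and ?L = "lists_of_length A k"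
  have fin: "finite ?L" using assms by simp
  have "complex_of_real (\<Sum>\<chi>\<in>?X. cmod (\<Sum>n\<in>A. \<chi> n) ^ (2 * k))
      = (\<Sum>\<chi>\<in>?X. \<Sum>u\<in>?L. \<Sum>v\<in>?L. \<chi> (prod_list u) * cnj (\<chi> (prod_list v)))"
    unfolding of_real_sum
  proof (rule sum.cong[OF refl])
    fix \<chi> assume "\<chi> \<in> ?X"
    then have \<chi>: "dirichlet_character q \<chi>" by simp
    have "complex_of_real (cmod (\<Sum>n\<in>A. \<chi> n) ^ (2 * k)) = complex_of_real ((cmod ((\<Sum>n\<in>A. \<chi> n) ^ k))\<^sup>2)"
      by (simp add: norm_power mult.commute flip: power_mult)
    also have "\<dots> = (\<Sum>u\<in>?L. \<chi> (prod_list u)) * cnj (\<Sum>v\<in>?L. \<chi> (prod_list v))"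
      by (simp only: complex_norm_square character_sum_power[OF \<chi>])
    finally show "complex_of_real (cmod (\<Sum>n\<in>A. \<chi> n) ^ (2 * k))
        = (\<Sum>u\<in>?L. \<Sum>v\<in>?L. \<chi> (prod_list u) * cnj (\<chi> (prod_list v)))"
      by (simp add: sum_product)
  qed
  also have "\<dots> = (\<Sum>u\<in>?L. \<Sum>v\<in>?L. \<Sum>\<chi>\<in>?X. \<chi> (prod_list u) * cnj (\<chi> (prod_list v)))"
    by (subst sum.swap) (intro sum.cong refl sum.swap)
  also have "\<dots> = (\<Sum>u\<in>?L. \<Sum>v\<in>?L. if prod_list u = prod_list v then of_nat (totient q) else 0)"
  proof (intro sum.cong refl)
    fix u v assume uv: "u \<in> ?L" "v \<in> ?L"
    have "coprime (prod_list u) q" "coprime (prod_list v) q"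
      using uv cop unfolding lists_of_length_def by (auto intro!: coprime_prod_list)
    moreover have "[prod_list u = prod_list v] (mod q) \<longleftrightarrow> prod_list u = prod_list v"
      using less[OF uv(1)] less[OF uv(2)] by (simp add: cong_def)
    ultimately show "(\<Sum>\<chi>\<in>?X. \<chi> (prod_list u) * cnj (\<chi> (prod_list v)))
        = (if prod_list u = prod_list v then of_nat (totient q) else 0)"
      using character_orthogonality[OF q] by simp
  qed
  also have "\<dots> = (\<Sum>p\<in>?L \<times> ?L. if prod_list (fst p) = prod_list (snd p) then of_nat (totient q) else 0)"
    by (simp add: sum.cartesian_product case_prod_unfold)
  also have "\<dots> = (\<Sum>p\<in>(?L \<times> ?L) \<inter> {p. prod_list (fst p) = prod_list (snd p)}. of_nat (totient q))"
    using fin by (subst sum.If_cases) auto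
  also have "(?L \<times> ?L) \<inter> {p. prod_list (fst p) = prod_list (snd p)}
      = {(u, v). u \<in> ?L \<and> v \<in> ?L \<and> prod_list u = prod_list v}" by auto
  also have "(\<Sum>p\<in>{(u, v). u \<in> ?L \<and> v \<in> ?L \<and> prod_list u = prod_list v}. of_nat (totient q) :: complex)
      = complex_of_real (real (totient q * mult_energy A k))"
    by (simp add: mult_energy_def)
  finally show ?thesis by (simp only: of_real_eq_iff)
qed

lemma finite_nat_le_real: "finite {n::nat. 1 \<le> n \<and> real n \<le> x}"
  by (rule finite_subset[of _ "{..nat \<lfloor>x\<rfloor>}"]) (auto simp: le_nat_floor)

lemma prod_list_le_power:
  assumes "\<And>n. n \<in> set u \<Longrightarrow> real n \<le> x"
  shows "real (prod_list u) \<le> x ^ length u"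
  using assms
proof (induction u)
  case (Cons n u)
  then have "real n \<le> x" "real (prod_list u) \<le> x ^ length u" by auto
  moreover from this have "0 \<le> x" using of_nat_0_le_iff order_trans by blast
  ultimately show ?case by (simp add: mult_mono)
qed simp

text \<open>The principal character contributes at most half of the \<open>2k\<close>-th moment because
  the products of \<open>k\<close> integers up to \<open>x\<close> occupy at most \<open>x ^ k\<close> residue classes.\<close>

lemma max_character_sum_power_ge:
  fixes x :: real
  assumes x: "x \<ge> 1" and k: "k \<ge> 1" and xk: "2 * x ^ k \<le> totient q"
  defines "A \<equiv> {n. 1 \<le> n \<and> real n \<le> x \<and> coprime n q}"
  shows "mult_energy A k \<le> 2 * max_character_sum q x ^ (2 * k)" "max_character_sum q x \<ge> 0"
proof -
  let ?X = "{\<chi>. dirichlet_character q \<chi>}" and ?N = "nonprincipal_characters q"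
  define E where "E = real (mult_energy A k)"
  have finA: "finite A" unfolding A_def by (rule finite_subset[OF _ finite_nat_le_real[of x]]) auto
  have one: "1 \<in> A" using x unfolding A_def by simp
  have "1 \<le> x ^ k" using x by simp
  then have phi: "totient q \<ge> 2" using xk by linarith
  have q: "q > 1"
  proof (rule ccontr)
    assume "\<not> q > 1"
    then have "q = 0 \<or> q = 1" by auto
    then show False using phi by auto
  qed
  have cs: "character_sum \<chi> x = (\<Sum>n\<in>A. \<chi> n)" if "dirichlet_character q \<chi>" for \<chi>
    unfolding character_sum_def
    by (rule sum.mono_neutral_right)
      (use that finite_nat_le_real in \<open>auto simp: A_def dirichlet_character_def\<close>)
  have bound: "real (prod_list u) \<le> x ^ k" "1 \<le> prod_list u" if "u \<in> lists_of_length A k" for u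
  proof -
    show "real (prod_list u) \<le> x ^ k"
      using prod_list_le_power[of u x] that unfolding lists_of_length_def A_def by auto
    have "0 \<notin> set u" using that unfolding lists_of_length_def A_def by auto
    then have "prod_list u \<noteq> 0" by (simp add: prod_list_zero_iff)
    then show "1 \<le> prod_list u" by simp
  qed
  have less: "prod_list u < q" if "u \<in> lists_of_length A k" for u
  proof -
    have "real (prod_list u) < real (totient q)"
      using bound(1)[OF that] xk \<open>1 \<le> x ^ k\<close> by linarith
    then show ?thesis using totient_le[of q] by linarith
  qed
  have "(\<Sum>\<chi>\<in>?X. cmod (\<Sum>n\<in>A. \<chi> n) ^ (2 * k)) = totient q * E"
    unfolding E_def using sum_moments_eq_energy[OF q finA _ less] by (simp add: A_def)
  then have total: "(\<Sum>\<chi>\<in>?X. cmod (character_sum \<chi> x) ^ (2 * k)) = totient q * E"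
    by (simp add: cs)
  have X: "?X = insert (principal_character q) ?N" "principal_character q \<notin> ?N"
    unfolding nonprincipal_characters_def using dirichlet_character_principal by auto
  have finN: "finite ?N" using finite_nonprincipal_characters q by simp
  have "character_sum (principal_character q) x = of_nat (card A)"
    using cs[OF dirichlet_character_principal] by (simp add: principal_character_def A_def)
  then have np: "(\<Sum>\<chi>\<in>?N. cmod (character_sum \<chi> x) ^ (2 * k)) = totient q * E - real (card A ^ (2 * k))"
    using total X finN by simp
  have "card (prod_list ` lists_of_length A k) \<le> card {1..nat \<lfloor>x ^ k\<rfloor>}"
    using bound by (intro card_mono) (auto simp: le_nat_floor)
  then have "real (card (prod_list ` lists_of_length A k)) \<le> x ^ k"
    using \<open>1 \<le> x ^ k\<close> by simp linarith
  moreover have "E \<ge> 0" unfolding E_def by simp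
  moreover have "real (card A ^ (2 * k)) \<le> real (card (prod_list ` lists_of_length A k)) * E"
    unfolding E_def using mult_energy_lower[OF finA subset_refl, of k]
    by (metis of_nat_le_iff of_nat_mult)
  ultimately have cardA: "real (card A ^ (2 * k)) \<le> x ^ k * E"
    by (meson mult_right_mono order_trans)
  also have "\<dots> \<le> totient q * E / 2"
    using mult_right_mono[OF xk \<open>E \<ge> 0\<close>] by simp
  finally have lower: "totient q * E / 2 \<le> (\<Sum>\<chi>\<in>?N. cmod (character_sum \<chi> x) ^ (2 * k))"
    using np by linarith
  have "card A > 0" using one finA card_gt_0_iff by blast
  then have "0 < x ^ k * E" using cardA by (metis of_nat_0_less_iff order_less_le_trans zero_less_power)
  then have "E > 0" using \<open>E \<ge> 0\<close> by (cases "E = 0") auto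
  \<comment> \<open>Needed because \<open>Max\<close> of an empty set is unspecified. The positive
    lower bound for the nonprincipal moment shows that nonprincipal characters exist.\<close>
  have "?N \<noteq> {}"
  proof
    assume "?N = {}"
    then show False using lower \<open>E > 0\<close> phi by (simp add: mult_le_0_iff)
  qed
  then obtain \<chi>1 where \<chi>1: "\<chi>1 \<in> ?N" by blast
  define M where "M = max_character_sum q x"
  have M: "cmod (character_sum \<chi> x) \<le> M" if "\<chi> \<in> ?N" for \<chi>
    unfolding M_def max_character_sum_def using finN that by (intro Max_ge) auto
  show M0: "max_character_sum q x \<ge> 0"
    using M[OF \<chi>1] norm_ge_zero order_trans unfolding M_def by blast
  have "(\<Sum>\<chi>\<in>?N. cmod (character_sum \<chi> x) ^ (2 * k)) \<le> (\<Sum>\<chi>\<in>?N. M ^ (2 * k))"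
    using M by (intro sum_mono power_mono) auto
  also have "\<dots> \<le> totient q * M ^ (2 * k)"
  proof -
    have "card ?N \<le> totient q"
      using card_dirichlet_characters[OF q] X finN by simp
    then show ?thesis using M0 unfolding M_def by (simp add: mult_right_mono)
  qed
  finally have "totient q * E / 2 \<le> totient q * M ^ (2 * k)" using lower by linarith
  then have "real (totient q) * E \<le> real (totient q) * (2 * M ^ (2 * k))" by simp
  then have "E \<le> 2 * M ^ (2 * k)" by (rule mult_left_le_imp_le) (use phi q in simp)
  then show "mult_energy A k \<le> 2 * max_character_sum q x ^ (2 * k)"
    unfolding E_def M_def .
qed

section \<open>Products of primes: many elements, few values\<close>

text \<open>A product depends only on the multiset of its factors, and there are
  \<open>(card S + n - 1) choose n\<close> multisets of size \<open>n\<close>.\<close>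

lemma card_prod_list_le:
  assumes "finite (S :: nat set)"
  shows "card (prod_list ` lists_of_length S n) * fact n \<le> (card S + n) ^ n"
proof -
  have "prod_list ` lists_of_length S n \<subseteq> prod_mset ` multisets_of_size S n"
  proof
    fix y assume "y \<in> prod_list ` lists_of_length S n"
    then obtain u where u: "y = prod_list u" "u \<in> lists_of_length S n" by blast
    have "mset u \<in> multisets_of_size S n"
      using u unfolding lists_of_length_def multisets_of_size_def by auto
    moreover have "y = prod_mset (mset u)" using u by (simp add: prod_mset_prod_list)
    ultimately show "y \<in> prod_mset ` multisets_of_size S n" by blast
  qed
  then have "card (prod_list ` lists_of_length S n) \<le> card (multisets_of_size S n)"
    using assms by (meson card_image_le card_mono finite_imageI finite_multisets_of_size order_trans)
  also have "\<dots> = (card S + n - 1) choose n" using card_multisets_of_size[OF assms] .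
  also have "\<dots> \<le> (card S + n) choose n" by (rule binomial_right_mono) simp
  finally have "card (prod_list ` lists_of_length S n) * fact n \<le> ((card S + n) choose n) * fact n"
    by simp
  also have "\<dots> \<le> (card S + n) ^ n" by (rule binomial_fact_pow)
  finally show ?thesis .
qed

definition prime_products :: "nat set \<Rightarrow> nat \<Rightarrow> nat set \<Rightarrow> nat set" where
  "prime_products P a R = (\<lambda>(u, s). s * prod_list u) ` (lists_of_length P a \<times> R)"

text \<open>By unique factorization the tuples with a given product are rearrangements of one
  multiset of \<open>a + 1\<close> primes, so a fibre has at most \<open>fact (Suc a)\<close>
  elements.\<close>

lemma card_prime_products_ge:
  assumes "finite P" "finite R" "\<And>p. p \<in> P \<Longrightarrow> prime p" "\<And>p. p \<in> R \<Longrightarrow> prime p"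
  shows "card P ^ a * card R \<le> card (prime_products P a R) * fact (Suc a)"
proof -
  let ?S = "lists_of_length P a \<times> R" and ?f = "\<lambda>(u, s). s * prod_list u"
  have fin: "finite ?S" using assms by simp
  have "card P ^ a * card R = card ?S"
    using assms by (simp add: card_cartesian_product card_lists_of_length)
  also have "\<dots> = (\<Sum>y\<in>?f ` ?S. card {z \<in> ?S. ?f z = y})"
    using sum.image_gen[OF fin, of "\<lambda>_. 1::nat" ?f] by simp
  also have "\<dots> \<le> (\<Sum>y\<in>?f ` ?S. fact (Suc a))"
  proof (rule sum_mono)
    fix y assume "y \<in> ?f ` ?S"
    let ?M = "prime_factorization y"
    have perm: "s # u \<in> permutations_of_multiset ?M" if "(u, s) \<in> ?S" "s * prod_list u = y" for u s
    proof -
      have "prime_factorization (prod_mset (mset (s # u))) = mset (s # u)"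
        using that assms unfolding lists_of_length_def by (intro prime_factorization_prod_mset_primes) auto
      moreover have "prod_mset (mset (s # u)) = y" using that by (simp add: prod_mset_prod_list)
      ultimately show ?thesis by (simp add: permutations_of_multiset_def)
    qed
    obtain u s where us: "(u, s) \<in> ?S" "s * prod_list u = y" using \<open>y \<in> ?f ` ?S\<close> by auto
    have "size ?M = length (s # u)"
      using perm[OF us] unfolding permutations_of_multiset_def by (metis mem_Collect_eq size_mset)
    then have size: "size ?M = Suc a" using us unfolding lists_of_length_def by simp
    have "card {z \<in> ?S. ?f z = y} = card ((\<lambda>(u, s). s # u) ` {z \<in> ?S. ?f z = y})"
      by (subst card_image) (auto simp: inj_on_def)
    also have "\<dots> \<le> card (permutations_of_multiset ?M)"
      using perm by (intro card_mono) auto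
    also have "\<dots> \<le> fact (Suc a)"
      unfolding card_permutations_of_multiset size by (rule div_le_dividend)
    finally show "card {z \<in> ?S. ?f z = y} \<le> fact (Suc a)" .
  qed
  finally show ?thesis unfolding prime_products_def by simp
qed

lemma prod_list_prime_products:
  assumes "v \<in> lists_of_length (prime_products P a R) k"
  shows "\<exists>u\<in>lists_of_length P (k * a). \<exists>w\<in>lists_of_length R k. prod_list v = prod_list u * prod_list w"
  using assms
proof (induction v arbitrary: k)
  case Nil
  then show ?case unfolding lists_of_length_def by auto
next
  case (Cons n v)
  then obtain k' where k: "k = Suc k'" "v \<in> lists_of_length (prime_products P a R) k'"
    "n \<in> prime_products P a R"
    unfolding lists_of_length_def by auto
  obtain u w where uw: "u \<in> lists_of_length P (k' * a)" "w \<in> lists_of_length R k'"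
    "prod_list v = prod_list u * prod_list w" using Cons.IH[OF k(2)] by blast
  obtain u1 s where us: "u1 \<in> lists_of_length P a" "s \<in> R" "n = s * prod_list u1"
    using k(3) unfolding prime_products_def by auto
  have "u1 @ u \<in> lists_of_length P (k * a)" "s # w \<in> lists_of_length R k"
    using uw us k unfolding lists_of_length_def by auto
  moreover have "prod_list (n # v) = prod_list (u1 @ u) * prod_list (s # w)"
    using uw us by (simp add: ac_simps)
  ultimately show ?case by blast
qed

text \<open>The \<open>k * a\<close> small primes and the \<open>k\<close> large ones are counted
  separately: \<open>R\<close> may be much bigger than \<open>P\<close>, and a joint count would
  raise the size of \<open>R\<close> to the power \<open>k * a\<close> too.\<close>

lemma card_prod_list_prime_products_le:
  assumes "finite P" "finite R"
  shows "card (prod_list ` lists_of_length (prime_products P a R) k) * (fact (k * a) * fact k)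
    \<le> (card P + k * a) ^ (k * a) * (card R + k) ^ k"
proof -
  let ?U = "prod_list ` lists_of_length P (k * a)" and ?W = "prod_list ` lists_of_length R k"
  have "prod_list ` lists_of_length (prime_products P a R) k \<subseteq> (\<lambda>(y, z). y * z) ` (?U \<times> ?W)"
    using prod_list_prime_products by fastforce
  then have "card (prod_list ` lists_of_length (prime_products P a R) k) \<le> card (?U \<times> ?W)"
    using assms by (intro surj_card_le) auto
  then have "card (prod_list ` lists_of_length (prime_products P a R) k) * (fact (k * a) * fact k)
      \<le> (card ?U * fact (k * a)) * (card ?W * fact k)"
    by (simp add: card_cartesian_product)
  also have "\<dots> \<le> (card P + k * a) ^ (k * a) * (card R + k) ^ k"
    using card_prod_list_le assms by (intro mult_mono) auto
  finally show ?thesis .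
qed

text \<open>The quotient \<open>n ^ n / fact n\<close> is a single term of the series for
  \<open>exp n\<close>.\<close>

lemma fact_ge_power_exp: "(real n / exp 1) ^ n \<le> fact n"
proof -
  have "real n ^ n / fact n \<le> exp (real n)"
  proof -
    have "(\<Sum>i\<in>{n}. real n ^ i / fact i) \<le> (\<Sum>i. real n ^ i / fact i)"
      using summable_exp[of "real n"] by (intro sum_le_suminf) (auto simp: divide_inverse mult.commute)
    then show ?thesis by (simp add: exp_def divide_inverse mult.commute)
  qed
  moreover have "exp (real n) = exp 1 ^ n" by (simp flip: exp_of_nat_mult)
  ultimately show ?thesis by (simp add: field_simps power_divide)
qed

text \<open>With \<open>V\<close> the left-hand side and \<open>M\<close> the maximum, the energy
  bounds give \<open>V ^ k \<le> E \<le> 2 * M ^ (2 * k)\<close>, which is at most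
  \<open>(2 * M ^ 2) ^ k\<close>. Taking \<open>k\<close>-th roots removes \<open>k\<close> from the
  exponents.\<close>

lemma max_character_sum_square_ge:
  fixes w Y x :: real
  assumes x: "x \<ge> 1" and k: "k \<ge> 1" and xk: "2 * x ^ k \<le> totient q"
    and P: "\<And>p. p \<in> P \<Longrightarrow> prime p \<and> coprime p q \<and> real p \<le> w"
    and R: "\<And>p. p \<in> R \<Longrightarrow> prime p \<and> coprime p q \<and> real p \<le> Y"
    and fin: "finite P" "finite R" and wY: "w ^ a * Y \<le> x"
  defines "p \<equiv> real (card P)" and "r \<equiv> real (card R)"
  shows "(p ^ a * r / fact (Suc a))\<^sup>2 * (real (k * a) / (exp 1 * (p + real (k * a)))) ^ a
           * (real k / (exp 1 * (r + real k))) \<le> 2 * (max_character_sum q x)\<^sup>2"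
    (is "?V \<le> _")
proof -
  define A where "A = {n. 1 \<le> n \<and> real n \<le> x \<and> coprime n q}"
  define A' where "A' = prime_products P a R"
  have finA: "finite A" unfolding A_def by (rule finite_subset[OF _ finite_nat_le_real[of x]]) auto
  have sub: "A' \<subseteq> A"
  proof
    fix n assume "n \<in> A'"
    then obtain u s where us: "set u \<subseteq> P" "length u = a" "s \<in> R" "n = s * prod_list u"
      unfolding A'_def prime_products_def lists_of_length_def by auto
    have "real (prod_list u) \<le> w ^ a"
      using prod_list_le_power[of u w] us P by auto
    then have "real n \<le> w ^ a * Y"
      using us R by (simp add: mult.commute) (meson mult_mono of_nat_0_le_iff order_trans)
    then have "real n \<le> x" using wY by linarith
    moreover have "coprime n q"
      using us R P by (auto intro!: coprime_prod_list)
    moreover have "n \<noteq> 0"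
    proof -
      have "0 \<notin> set u" using us(1) P by (meson not_prime_0 subsetD)
      then have "prod_list u \<noteq> 0" by (simp add: prod_list_zero_iff)
      moreover have "s \<noteq> 0" using R[OF us(3)] by (metis not_prime_0)
      ultimately show ?thesis using us by simp
    qed
    ultimately show "n \<in> A" unfolding A_def by simp
  qed
  define E where "E = real (mult_energy A k)"
  have E: "E \<le> 2 * max_character_sum q x ^ (2 * k)"
    using max_character_sum_power_ge[OF x k xk] unfolding E_def A_def by simp
  define D where "D = real (card (prod_list ` lists_of_length A' k))"
  have DE: "real (card A') ^ (2 * k) \<le> D * E"
    using mult_energy_lower[OF finA sub, of k] unfolding D_def E_def
    by (metis of_nat_le_iff of_nat_mult of_nat_power)
  have "real (card P ^ a * card R) \<le> real (card A' * fact (Suc a))"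
    using card_prime_products_ge[of P R a] fin P R unfolding A'_def of_nat_le_iff by blast
  then have "p ^ a * r / fact (Suc a) \<le> real (card A')"
    unfolding p_def r_def by (simp add: field_simps del: fact_Suc)
  then have cardA: "(p ^ a * r / fact (Suc a)) ^ (2 * k) \<le> real (card A') ^ (2 * k)"
    unfolding p_def r_def by (intro power_mono) auto
  define K where "K = k * a"
  have "real (card (prod_list ` lists_of_length A' k) * (fact K * fact k))
      \<le> real ((card P + K) ^ K * (card R + k) ^ k)"
    using card_prod_list_prime_products_le[OF fin, of a k] unfolding K_def A'_def of_nat_le_iff .
  then have Dle: "D * (fact K * fact k) \<le> (p + real K) ^ K * (r + real k) ^ k"
    unfolding D_def p_def r_def by simp
  have D0: "D \<ge> 0" unfolding D_def by simp
  have pr: "p \<ge> 0" "r \<ge> 0" unfolding p_def r_def by auto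
  have "D * ((real K / exp 1) ^ K * (real k / exp 1) ^ k) \<le> D * (fact K * fact k)"
    using fact_ge_power_exp D0 by (intro mult_left_mono mult_mono) auto
  also note Dle
  finally have D1: "D * ((real K / exp 1) ^ K * (real k / exp 1) ^ k) \<le> (p + real K) ^ K * (r + real k) ^ k" .
  \<comment> \<open>For \<open>a = 0\<close> the exponent \<open>K\<close> is 0, and the first power
    is 1 even if \<open>P\<close> is empty.\<close>
  have pos: "(p + real K) ^ K > 0" "(r + real k) ^ k > 0"
    using pr k by (cases "K = 0"; simp)+
  \<comment> \<open>Chosen so that \<open>D * Z ^ k \<le> 1\<close>, with the bound for
    \<open>D\<close> written as an exact \<open>k\<close>-th power.\<close>
  define Z where "Z = (real K / (exp 1 * (p + real K))) ^ a * (real k / (exp 1 * (r + real k)))"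
  have "Z ^ k = ((real K / exp 1) ^ K * (real k / exp 1) ^ k) / ((p + real K) ^ K * (r + real k) ^ k)"
  proof -
    have "Z ^ k = (real K / (exp 1 * (p + real K))) ^ K * (real k / (exp 1 * (r + real k))) ^ k"
      unfolding Z_def K_def by (simp only: power_mult_distrib mult.commute[of k a] power_mult)
    also have "\<dots> = ((real K / exp 1) ^ K / (p + real K) ^ K) * ((real k / exp 1) ^ k / (r + real k) ^ k)"
      by (simp add: power_divide power_mult_distrib)
    finally show ?thesis by simp
  qed
  then have DZ: "D * Z ^ k \<le> 1" using D1 pos by (simp add: divide_le_eq)
  have Z0: "Z \<ge> 0" unfolding Z_def using pr by simp
  have E0: "E \<ge> 0" unfolding E_def by simp
  have V: "?V = (p ^ a * r / fact (Suc a))\<^sup>2 * Z"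
    unfolding Z_def K_def by (simp only: mult.assoc)
  have "?V ^ k = (p ^ a * r / fact (Suc a)) ^ (2 * k) * Z ^ k"
    unfolding V by (simp only: power_mult_distrib power_mult)
  also have "\<dots> \<le> D * E * Z ^ k"
    using cardA DE Z0 by (intro mult_right_mono) auto
  also have "\<dots> \<le> E" using mult_right_mono[OF DZ E0] by (simp add: ac_simps)
  finally have Vk: "?V ^ k \<le> 2 * ((max_character_sum q x)\<^sup>2) ^ k"
    using E by (simp add: power_mult)
  also have "\<dots> \<le> 2 ^ k * ((max_character_sum q x)\<^sup>2) ^ k"
    using k self_le_power[of "2::real" k] by (intro mult_right_mono) auto
  finally have "?V ^ k \<le> (2 * (max_character_sum q x)\<^sup>2) ^ k"
    by (simp only: power_mult_distrib)
  then show ?thesis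
    using k power_mono_iff[of ?V "2 * (max_character_sum q x)\<^sup>2" k] Z0 unfolding V by simp
qed

subsection \<open>Lower bounds for the moments\<close>

text \<open>The induction step is \<open>(n / (n + 1)) ^ (n + 1) \<le> exp (- 1)\<close>. The factor
  \<open>n + 1\<close> in place of \<open>n\<close> makes the bound valid at
  \<open>n = 0\<close>.\<close>

lemma fact_le_power_exp: "fact n \<le> exp 1 * (real n + 1) * (real n / exp 1) ^ n"
proof (cases "n = 0")
  case False
  then have "n \<ge> 1" by simp
  then have "fact n \<le> exp 1 * real n * (real n / exp 1) ^ n"
  proof (induction n rule: nat_induct_at_least)
    case (Suc n)
    have "(real n / (real n + 1)) ^ (n + 1) \<le> exp (- 1 / (real n + 1)) ^ (n + 1)"
      using exp_ge_add_one_self[of "- 1 / (real n + 1)"]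
      by (intro power_mono) (auto simp: field_simps)
    also have "\<dots> = exp (real (n + 1) * (- 1 / (real n + 1)))" by (rule exp_of_nat_mult[symmetric])
    also have "real (n + 1) * (- 1 / (real n + 1)) = - 1" by (simp add: field_simps)
    finally have "real n ^ (n + 1) * exp 1 \<le> (real n + 1) ^ (n + 1)"
      by (simp add: power_divide pos_divide_le_eq exp_minus divide_simps mult.commute del: power_Suc)
    then have *: "real n * (real n / exp 1) ^ n \<le> (real (Suc n) / exp 1) ^ Suc n"
      by (simp add: power_divide field_simps)
    have "fact (Suc n) \<le> real (Suc n) * (exp 1 * real n * (real n / exp 1) ^ n)"
      using Suc by (simp add: mult_left_mono)
    also have "\<dots> = exp 1 * real (Suc n) * (real n * (real n / exp 1) ^ n)" by (simp only: ac_simps)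
    also have "\<dots> \<le> exp 1 * real (Suc n) * (real (Suc n) / exp 1) ^ Suc n"
      using * by (intro mult_left_mono) auto
    finally show ?case .
  qed simp
  also have "\<dots> \<le> exp 1 * (real n + 1) * (real n / exp 1) ^ n"
    by (intro mult_right_mono mult_left_mono) auto
  finally show ?thesis .
qed simp

text \<open>Up to a factor \<open>p\<close> this is \<open>p * m / (p + m)\<close>, the reciprocal
  of \<open>1 / p + 1 / m\<close>, which increases in both variables. It allows lower bounds for the
  prime counts and for \<open>k\<close> to be inserted although these also occur in
  denominators.\<close>

lemma harmonic_mono:
  fixes p m :: real
  assumes "p0 > 0" "m0 > 0" "p0 \<le> p" "m0 \<le> m"
  shows "p0\<^sup>2 * m0 / (p0 + m0) \<le> p\<^sup>2 * m / (p + m)"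
proof -
  have "p0 * m0 \<le> p * m" using assms by (intro mult_mono) auto
  then have 1: "(p * p0) * (p0 * m0) \<le> (p * p0) * (p * m)" using assms by (intro mult_left_mono) auto
  have "p0\<^sup>2 \<le> p\<^sup>2" using assms by (intro power_mono) auto
  then have 2: "p0\<^sup>2 * (m0 * m) \<le> p\<^sup>2 * (m0 * m)" using assms by (intro mult_right_mono) auto
  have "p0\<^sup>2 * m0 * (p + m) \<le> p\<^sup>2 * m * (p0 + m0)"
    using 1 2 by (simp add: algebra_simps power2_eq_square)
  then show ?thesis using assms by (simp add: divide_le_eq pos_le_divide_eq)
qed

text \<open>The first factor comes from Bernoulli's inequality for \<open>1.08 ^ a\<close>, the
  16/29 and one \<open>exp 1\<close> from the large prime, and \<open>exp 1 ^ 2\<close> from the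
  square of the upper bound for \<open>fact (Suc a)\<close>.\<close>

definition moment_const :: real where
  "moment_const = (8/100) ^ 4 * 16 / (29 * exp 1 ^ 3)"

lemma moment_const_pos: "moment_const > 0"
  unfolding moment_const_def by simp

text \<open>The number \<open>1.08 ^ 4\<close> bounds from below the gain per prime factor; any constant above \<open>1\<close>
  absorbs the polynomial losses in \<open>a\<close>.\<close>

lemma moment_lower_bound:
  fixes w Y X p r :: real
  assumes w: "1 \<le> w" "w \<le> Y" and X: "X > 0"
    and p: "p \<ge> w * real a / (2 * X)" and r: "r \<ge> Y / (2 * X)" and k: "real k \<ge> 8/100 * w / X"
  shows "moment_const * (w ^ (2 * a + 1) * Y) / (4 * X) ^ (2 * Suc a)
    \<le> (p ^ a * r / fact (Suc a))\<^sup>2 * (real (k * a) / (exp 1 * (p + real (k * a)))) ^ a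
           * (real k / (exp 1 * (r + real k)))"
proof -
  define e where "e = exp (1::real)"
  have e: "e \<ge> 5/2" using exp_lower_Taylor_quadratic[of 1] unfolding e_def by simp
  define F where "F = e * (real a + 1)\<^sup>2 * (real a / e) ^ a"
  have Y: "Y > 0" using w by simp
  have p0: "p \<ge> 0" using p w X by (meson divide_nonneg_nonneg mult_nonneg_nonneg of_nat_0_le_iff order_trans zero_le_one less_imp_le zero_le_numeral)
  have "0 < Y / (2 * X)" using Y X by simp
  then have r0: "r > 0" using r by linarith
  have "0 < 8/100 * w / X" using w X by simp
  then have k0: "real k > 0" using k by linarith
  have F: "0 < (fact (Suc a) :: real)" "fact (Suc a) \<le> F"
  proof -
    have "fact (Suc a) = (real a + 1) * fact a" by simp
    also have "\<dots> \<le> (real a + 1) * (e * (real a + 1) * (real a / e) ^ a)"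
      using fact_le_power_exp[of a] unfolding e_def by (intro mult_left_mono) auto
    finally show "fact (Suc a) \<le> F" unfolding F_def by (simp add: power2_eq_square ac_simps)
  qed simp
  have block: "(1.08 ^ 4 * (w / (4 * X))\<^sup>2) ^ a
      \<le> (p\<^sup>2 * (e / real a)\<^sup>2 * (real (k * a) / (e * (p + real (k * a))))) ^ a"
  \<comment> \<open>For \<open>a = 0\<close> the quotient \<open>e / real a\<close> takes the
    default value 0; as an inequality of \<open>a\<close>-th powers the claim still reads
    \<open>1 \<le> 1\<close>.\<close>
  proof (cases "a = 0")
    case False
    then have a: "real a > 0" by simp
    define P M where "P = w * real a / (2 * X)" and "M = 8/100 * (w * real a / X)"
    have PM: "P > 0" "M > 0" unfolding P_def M_def using w X a by auto
    have "M \<le> real (k * a)" using mult_right_mono[OF k, of "real a"] unfolding M_def by simp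
    then have hm: "P\<^sup>2 * M / (P + M) \<le> p\<^sup>2 * real (k * a) / (p + real (k * a))"
      using p PM unfolding P_def by (intro harmonic_mono) auto
    \<comment> \<open>Here 58/100 is 1/2 + 8/100, and (1/2)^2 * (8/100) / (58/100) = 1/29.\<close>
    have "P + M = 58/100 * (w * real a / X)" unfolding P_def M_def by (simp add: field_simps)
    then have "P\<^sup>2 * M / (P + M) = (w * real a / X)\<^sup>2 / 29"
      unfolding P_def M_def using w X a by (simp add: field_simps power2_eq_square)
    then have "(w * real a / X)\<^sup>2 / 29 \<le> p\<^sup>2 * real (k * a) / (p + real (k * a))"
      using hm by linarith
    then have "(e / (real a)\<^sup>2) * ((w * real a / X)\<^sup>2 / 29)
        \<le> (e / (real a)\<^sup>2) * (p\<^sup>2 * real (k * a) / (p + real (k * a)))"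
      using e by (intro mult_left_mono) auto
    also have "\<dots> = p\<^sup>2 * (e / real a)\<^sup>2 * (real (k * a) / (e * (p + real (k * a))))"
      using e by (simp add: power2_eq_square)
    also have "(e / (real a)\<^sup>2) * ((w * real a / X)\<^sup>2 / 29) = 16 * e / 29 * (w / (4 * X))\<^sup>2"
      using a by (simp add: power2_eq_square)
    finally have "16 * e / 29 * (w / (4 * X))\<^sup>2
        \<le> p\<^sup>2 * (e / real a)\<^sup>2 * (real (k * a) / (e * (p + real (k * a))))" .
    \<comment> \<open>From \<open>e \<ge> 5/2\<close> the factor \<open>16 * e / 29\<close> is at
      least 40/29, about 1.379, whereas \<open>1.08 ^ 4\<close> is about 1.360.\<close>
    moreover have "1.08 ^ 4 * (w / (4 * X))\<^sup>2 \<le> 16 * e / 29 * (w / (4 * X))\<^sup>2"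
      using e by (intro mult_right_mono) (auto simp: power4_eq_xxxx)
    ultimately have "1.08 ^ 4 * (w / (4 * X))\<^sup>2
        \<le> p\<^sup>2 * (e / real a)\<^sup>2 * (real (k * a) / (e * (p + real (k * a))))"
      by (rule order_trans[rotated])
    then show ?thesis by (rule power_mono) simp
  qed simp
  have final: "16 / 29 * (Y * w / (4 * X)\<^sup>2) / e \<le> r\<^sup>2 * (real k / (e * (r + real k)))"
  proof -
    define R M where "R = Y / (2 * X)" and "M = 8/100 * w / X"
    have RM: "R > 0" "M > 0" unfolding R_def M_def using w X Y by auto
    have "R\<^sup>2 * M / (R + M) \<le> r\<^sup>2 * real k / (r + real k)"
      using r k RM unfolding R_def M_def by (intro harmonic_mono) auto
    \<comment> \<open>By \<open>w \<le> Y\<close> the denominator is controlled by \<open>Y\<close>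
      alone. The numerator keeps the factor \<open>w\<close> of \<open>M\<close>, so the result has
      \<open>Y * w\<close> in place of the square of \<open>Y\<close>.\<close>
    moreover have "R + M \<le> 58/100 * (Y / X)"
      unfolding R_def M_def using w X by (simp add: field_simps)
    then have "R\<^sup>2 * M / (58/100 * (Y / X)) \<le> R\<^sup>2 * M / (R + M)"
      using RM by (intro divide_left_mono mult_pos_pos) (auto intro: add_pos_pos)
    moreover have "R\<^sup>2 * M / (58/100 * (Y / X)) = 16 / 29 * (Y * w / (4 * X)\<^sup>2)"
      unfolding R_def M_def using Y X by (simp add: field_simps power2_eq_square)
    ultimately have "16 / 29 * (Y * w / (4 * X)\<^sup>2) \<le> r\<^sup>2 * real k / (r + real k)" by linarith
    then have "16 / 29 * (Y * w / (4 * X)\<^sup>2) / e \<le> r\<^sup>2 * real k / (r + real k) / e"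
      using e by (intro divide_right_mono) auto
    then show ?thesis by (simp add: ac_simps)
  qed
  \<comment> \<open>The bound \<open>F\<close> carries \<open>(real a + 1) ^ 2\<close> and enters
    squared; hence the fourth power of Bernoulli's inequality.\<close>
  have "1 + real a * (8/100) \<le> 1.08 ^ a"
    using Bernoulli_inequality[of "8/100" a] by simp
  then have "8/100 * (real a + 1) \<le> 1.08 ^ a" by (simp add: algebra_simps)
  then have "(8/100 * (real a + 1)) ^ 4 \<le> (1.08 ^ a) ^ 4" by (intro power_mono) auto
  then have bern: "(8/100) ^ 4 * (real a + 1) ^ 4 \<le> (1.08 ^ 4) ^ a"
    by (simp only: power_mult_distrib mult.commute[of a 4] flip: power_mult)
  have F0: "F > 0" using F by linarith
  define g Z where "g = (w / (4 * X))\<^sup>2" and "Z = Y * w / (4 * X)\<^sup>2"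
  define u c1 c2 D where "u = p\<^sup>2 * (e / real a)\<^sup>2" and "c1 = real (k * a) / (e * (p + real (k * a)))"
    and "c2 = real k / (e * (r + real k))" and "D = e * (real a + 1)\<^sup>2"
  have D: "D > 0" unfolding D_def using e by simp
  have c: "c1 \<ge> 0" "c2 \<ge> 0" "u \<ge> 0" "g \<ge> 0" "Z \<ge> 0"
    unfolding c1_def c2_def u_def g_def Z_def using p0 r0 e w by auto
  have "w ^ (2 * a + 1) * Y / (4 * X) ^ (2 * Suc a) = g ^ a * Z"
  proof -
    have "(4 * X) ^ (2 * Suc a) = (4 * X) ^ (2 * a) * (4 * X)\<^sup>2"
      by (simp only: power_add[symmetric]) simp
    moreover have "g ^ a = w ^ (2 * a) / (4 * X) ^ (2 * a)"
      unfolding g_def by (simp only: power_divide power_mult)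
    moreover have "w ^ (2 * a + 1) * Y = w ^ (2 * a) * (Y * w)" by simp
    ultimately show ?thesis unfolding Z_def by (simp only: times_divide_times_eq)
  qed
  then have "moment_const * (w ^ (2 * a + 1) * Y) / (4 * X) ^ (2 * Suc a) = moment_const * (g ^ a * Z)"
    by (simp only: times_divide_eq_right[symmetric])
  also have "\<dots> = (8/100) ^ 4 * (g ^ a * (16 / 29 * Z / e) / e\<^sup>2)"
    unfolding moment_const_def e_def[symmetric] by (simp add: power2_eq_square power3_eq_cube)
  also have "\<dots> \<le> ((1.08 ^ 4) ^ a / (real a + 1) ^ 4) * (g ^ a * (16 / 29 * Z / e) / e\<^sup>2)"
    using bern c e by (intro mult_right_mono) (auto simp: pos_le_divide_eq)
  also have "\<dots> = (1.08 ^ 4 * g) ^ a * (16 / 29 * Z / e) / D\<^sup>2"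
  proof -
    have "(1.08 ^ 4 * g) ^ a = (1.08 ^ 4) ^ a * g ^ a" by (rule power_mult_distrib)
    moreover have "D\<^sup>2 = (real a + 1) ^ 4 * e\<^sup>2" unfolding D_def by (simp add: power_mult_distrib)
    ultimately show ?thesis by (simp only: times_divide_times_eq mult.assoc)
  qed
  also have "\<dots> \<le> (u * c1) ^ a * (r\<^sup>2 * c2) / D\<^sup>2"
    using block final c e unfolding u_def[symmetric] c1_def[symmetric] c2_def[symmetric] g_def[symmetric] Z_def[symmetric]
    by (intro divide_right_mono mult_mono) auto
  also have "\<dots> = (p ^ a * r / F)\<^sup>2 * (c1 ^ a * c2)"
  proof -
    have "u ^ a = (p ^ a * (e / real a) ^ a)\<^sup>2"
      unfolding u_def by (simp only: power_mult_distrib power_mult[symmetric] mult.commute[of a 2])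
    moreover have "(e / real a) ^ a = 1 / (real a / e) ^ a" by (simp add: power_divide)
    ultimately have "u ^ a / D\<^sup>2 = (p ^ a / F)\<^sup>2"
      unfolding F_def D_def[symmetric] by (simp add: power_mult_distrib power_divide)
    moreover have "(u * c1) ^ a * (r\<^sup>2 * c2) / D\<^sup>2 = (u ^ a / D\<^sup>2) * r\<^sup>2 * (c1 ^ a * c2)"
      by (simp add: power_mult_distrib)
    moreover have "(p ^ a * r / F)\<^sup>2 = (p ^ a / F)\<^sup>2 * r\<^sup>2"
      by (simp add: power_mult_distrib power_divide)
    ultimately show ?thesis by (simp only:)
  qed
  also have "\<dots> \<le> (p ^ a * r / fact (Suc a))\<^sup>2 * (c1 ^ a * c2)"
  proof (intro mult_right_mono power_mono)
    show "p ^ a * r / F \<le> p ^ a * r / fact (Suc a)"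
      using F F0 p0 r0 by (intro divide_left_mono mult_pos_pos) (auto simp del: fact_Suc)
  qed (use c F0 p0 r0 in \<open>auto simp del: fact_Suc\<close>)
  finally show ?thesis unfolding c1_def c2_def e_def by (simp only: mult.assoc)
qed

section \<open>The lower bound with \<open>w\<close>, \<open>Y\<close> and \<open>a\<close> still
  free\<close>

definition coprime_primes :: "nat \<Rightarrow> real \<Rightarrow> nat set" where
  "coprime_primes q t = {p. prime p \<and> coprime p q \<and> real p \<le> t}"

lemma finite_coprime_primes: "finite (coprime_primes q t)"
  unfolding coprime_primes_def by (rule finite_subset[OF _ finite_primes_le_real[of t]]) auto

text \<open>The 2 undoes the factor on the right of the moment inequality, which stems from the
  principal character; the root returns from the square of the maximum to the maximum.\<close>

definition large_sum_const :: real where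
  "large_sum_const = sqrt (moment_const / 2)"

lemma large_sum_const_pos: "large_sum_const > 0"
  unfolding large_sum_const_def using moment_const_pos by simp

lemma max_character_sum_ge:
  fixes q :: nat and w Y x :: real
  defines "X \<equiv> ln x"
  assumes q: "2 * real q powr (9/10) \<le> totient q"
    and x: "x > 1" "X \<le> ln q / 10"
    and w: "1 \<le> w" "w \<le> Y" "w \<le> 10 * ln q" and wY: "w ^ a * Y \<le> x"
    and P: "real (card (coprime_primes q w)) * ln w \<ge> w / 2"
    and R: "real (card (coprime_primes q Y)) * ln Y \<ge> Y / 2"
  shows "max_character_sum q x \<ge> large_sum_const * (sqrt (w ^ (2 * a + 1) * Y) / (4 * X) ^ Suc a)"
proof -
  have X: "X > 0" unfolding X_def using x by simp
  then have L: "ln q > 0" using x by simp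
  then have q0: "real q > 0" by (cases "q = 0") auto
  \<comment> \<open>This \<open>k\<close> is the largest with
    \<open>x ^ k \<le> q powr (9/10)\<close>, matching the assumption on \<open>totient q\<close>.
    Since \<open>ln q / X \<ge> 10\<close>, rounding costs at most a tenth of
    \<open>ln q / X\<close>, which leaves 8/10.\<close>
  define k where "k = nat \<lfloor>9/10 * ln q / X\<rfloor>"
  have quot: "ln q / X \<ge> 10" using x X by (simp add: field_simps)
  then have k: "real k \<le> 9/10 * ln q / X" "9/10 * ln q / X < real k + 1"
    unfolding k_def by linarith+
  then have k8: "real k \<ge> 8/10 * (ln q / X)" "k \<ge> 1" using quot by auto
  \<comment> \<open>The bound \<open>w \<le> 10 * ln q\<close> enters here; it keeps
    \<open>k\<close> at least proportional to \<open>w / X\<close>.\<close>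
  have "8/100 * w / X \<le> 8/10 * (ln q / X)"
    using divide_right_mono[OF w(3), of X] X by simp
  then have kw: "real k \<ge> 8/100 * w / X" using k8 by linarith
  have "x ^ k = exp (real k * X)" unfolding X_def using x by (simp add: exp_of_nat_mult)
  also have "\<dots> \<le> exp (9/10 * ln q)" using k X by (simp add: field_simps)
  also have "\<dots> = real q powr (9/10)" using q0 by (simp add: powr_def)
  finally have xk: "2 * x ^ k \<le> totient q" using q by simp
  have wpow: "1 \<le> w ^ a" using w by simp
  have "w ^ a * 1 \<le> w ^ a * Y" using w by (intro mult_left_mono) auto
  then have "w ^ a \<le> x" using wY by simp
  then have "ln (w ^ a) \<le> X" unfolding X_def using w x by (subst ln_le_cancel_iff) auto
  then have aw: "real a * ln w \<le> X" using w by (simp add: ln_realpow)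
  have "1 * Y \<le> w ^ a * Y" using w wpow by (intro mult_right_mono) auto
  then have "Y \<le> x" using wY by simp
  then have YX: "ln Y \<le> X" unfolding X_def using w x by (subst ln_le_cancel_iff) auto
  \<comment> \<open>Using \<open>a * ln w \<le> X\<close> instead of \<open>ln w \<le> X\<close>
    gains the factor \<open>a\<close> that is later cancelled against the factorial.\<close>
  have "w / 2 * real a \<le> real (card (coprime_primes q w)) * (real a * ln w)"
    using mult_right_mono[OF P, of "real a"] by (simp add: ac_simps)
  also have "\<dots> \<le> real (card (coprime_primes q w)) * X" using aw by (intro mult_left_mono) auto
  finally have p: "real (card (coprime_primes q w)) \<ge> w * real a / (2 * X)"
    using X by (simp add: divide_le_eq)
  have "Y / 2 \<le> real (card (coprime_primes q Y)) * X"
    using R mult_left_mono[OF YX, of "real (card (coprime_primes q Y))"] by simp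
  then have r: "real (card (coprime_primes q Y)) \<ge> Y / (2 * X)"
    using X by (simp add: divide_le_eq)
  have "moment_const * (w ^ (2 * a + 1) * Y) / (4 * X) ^ (2 * Suc a) \<le> 2 * (max_character_sum q x)\<^sup>2"
  proof (rule order_trans[OF moment_lower_bound[OF w(1,2) X p r kw]])
    show "(real (card (coprime_primes q w)) ^ a * real (card (coprime_primes q Y)) / fact (Suc a))\<^sup>2
        * (real (k * a) / (exp 1 * (real (card (coprime_primes q w)) + real (k * a)))) ^ a
        * (real k / (exp 1 * (real (card (coprime_primes q Y)) + real k))) \<le> 2 * (max_character_sum q x)\<^sup>2"
    proof (rule max_character_sum_square_ge[OF _ k8(2) xk _ _ _ _ wY])
      show "1 \<le> x" using x by simp
    qed (simp_all add: finite_coprime_primes, simp_all add: coprime_primes_def)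
  qed
  then have "moment_const * (w ^ (2 * a + 1) * Y) / ((4 * X) ^ Suc a)\<^sup>2 \<le> 2 * (max_character_sum q x)\<^sup>2"
    by (simp only: mult.commute[of 2 "Suc a"] power_mult)
  then have "moment_const / 2 * (w ^ (2 * a + 1) * Y) / ((4 * X) ^ Suc a)\<^sup>2 \<le> (max_character_sum q x)\<^sup>2"
  proof -
    have "c / 2 * T / d = c * T / d / 2" for c T d :: real by simp
    then show ?thesis
      using \<open>moment_const * (w ^ (2 * a + 1) * Y) / ((4 * X) ^ Suc a)\<^sup>2 \<le> 2 * (max_character_sum q x)\<^sup>2\<close>
      by (metis divide_right_mono nonzero_mult_div_cancel_left zero_le_numeral zero_neq_numeral)
  qed
  then have "sqrt (moment_const / 2 * (w ^ (2 * a + 1) * Y) / ((4 * X) ^ Suc a)\<^sup>2) \<le> sqrt ((max_character_sum q x)\<^sup>2)"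
    by (rule real_sqrt_le_mono)
  moreover have "max_character_sum q x \<ge> 0"
    using max_character_sum_power_ge(2)[OF _ k8(2) xk] x by simp
  moreover have "sqrt (moment_const / 2 * (w ^ (2 * a + 1) * Y) / ((4 * X) ^ Suc a)\<^sup>2)
      = large_sum_const * (sqrt (w ^ (2 * a + 1) * Y) / (4 * X) ^ Suc a)"
    unfolding large_sum_const_def using X
    by (simp only: real_sqrt_mult real_sqrt_divide real_sqrt_abs abs_of_pos zero_less_power
        zero_less_mult_iff zero_less_numeral simp_thms times_divide_eq_right)
  ultimately show ?thesis by simp
qed

subsection \<open>Primes not dividing the modulus\<close>

text \<open>The \<open>i\<close>-th smallest element of a set of positive integers is at least
  \<open>i\<close>.\<close>

lemma fact_card_le_prod:
  assumes "finite S" "0 \<notin> (S :: nat set)"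
  shows "fact (card S) \<le> \<Prod>S"
  using assms
proof (induction S rule: finite_linorder_max_induct)
  case (insert b A)
  have "A \<subseteq> {1..<b}" using insert by (auto simp: Suc_le_eq intro: Nat.gr0I)
  then have "card A \<le> b - 1" using card_mono[of "{1..<b}" A] by simp
  moreover have "b > 0" using insert by auto
  ultimately have "Suc (card A) \<le> b" by simp
  moreover have "b \<notin> A" using insert by auto
  ultimately show ?case using insert by (simp del: mult_Suc) (intro mult_mono; simp)
qed simp

text \<open>With \<open>m\<close> distinct prime factors, \<open>fact m \<le> q\<close>; now insert
  \<open>(m / e) ^ m \<le> fact m\<close> and take logarithms.\<close>

lemma card_prime_factors_bound:
  assumes "q > 0"
  shows "real (card (prime_factors q)) * (ln (real (card (prime_factors q))) - 1) \<le> ln (real q)"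
proof (cases "card (prime_factors q) = 0")
  case False
  define m where "m = card (prime_factors q)"
  have "fact m \<le> \<Prod>(prime_factors q)"
    unfolding m_def by (intro fact_card_le_prod) auto
  also have "\<dots> \<le> (\<Prod>p\<in>prime_factors q. p ^ multiplicity p q)"
  proof (intro prod_mono conjI)
    fix p assume p: "p \<in> prime_factors q"
    then have "multiplicity p q \<ge> 1" "p \<ge> 1"
      by (auto simp: prime_factors_multiplicity Suc_le_eq prime_gt_0_nat)
    then show "p \<le> p ^ multiplicity p q" using self_le_power[of p "multiplicity p q"] by simp
  qed simp
  also have "\<dots> = q" using assms by (simp flip: prime_factorization_nat)
  finally have "real (fact m) \<le> real q" by (simp only: of_nat_le_iff)
  then have "(real m / exp 1) ^ m \<le> real q" using fact_ge_power_exp[of m] by simp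
  moreover have m: "real m > 0" using False unfolding m_def of_nat_0_less_iff by blast
  ultimately have "ln ((real m / exp 1) ^ m) \<le> ln (real q)"
    using assms by (subst ln_le_cancel_iff) auto
  moreover have "ln ((real m / exp 1) ^ m) = real m * (ln (real m) - 1)"
    using m by (simp add: ln_realpow ln_div)
  ultimately show ?thesis unfolding m_def by simp
qed (use assms in simp)

text \<open>The function \<open>u * (ln u - 1)\<close> is increasing for \<open>u \<ge> e\<close>
  and exceeds \<open>ln q\<close> at the claimed bound, so the preceding lemma excludes more prime
  factors. In terms of \<open>y = 10 * ln q\<close> the bound is
  \<open>0.15 * y / ln y\<close>.\<close>

lemma eventually_card_prime_factors_le:
  "\<forall>\<^sub>F q::nat in at_top. real (card (prime_factors q)) \<le> 15/10 * ln q / ln (10 * ln q)"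
proof -
  have "\<forall>\<^sub>F q::nat in at_top. 15/10 * ln (real q) / ln (10 * ln (real q)) \<ge> exp 1" by real_asymp
  moreover have "\<forall>\<^sub>F q::nat in at_top. (15/10 * ln (real q) / ln (10 * ln (real q))) *
      (ln (15/10 * ln (real q) / ln (10 * ln (real q))) - 1) > ln (real q)" by real_asymp
  ultimately show ?thesis using eventually_gt_at_top[of 0]
  proof eventually_elim
    case (elim q)
    define v where "v = 15/10 * ln (real q) / ln (10 * ln (real q))"
    define m where "m = real (card (prime_factors q))"
    have v: "v \<ge> exp 1" "v * (ln v - 1) > ln (real q)" using elim unfolding v_def by auto
    have "v > 0" using v(1) exp_gt_zero[of "1::real"] by linarith
    have "ln v \<ge> ln (exp 1)" using v(1) \<open>v > 0\<close> by (subst ln_le_cancel_iff) auto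
    then have lnv: "ln v \<ge> 1" by simp
    have "m \<le> v"
    proof (rule ccontr)
      assume "\<not> m \<le> v"
      then have "v \<le> m" by simp
      moreover have "ln v \<le> ln m" using \<open>v \<le> m\<close> \<open>v > 0\<close> by simp
      ultimately have "v * (ln v - 1) \<le> m * (ln m - 1)"
        using \<open>v > 0\<close> lnv by (intro mult_mono) auto
      then show False using card_prime_factors_bound[OF elim(3)] v(2) unfolding m_def by linarith
    qed
    then show ?case unfolding m_def v_def .
  qed
qed

lemma card_coprime_primes_ge:
  assumes "q > 0"
  shows "real (card {p::nat. prime p \<and> real p \<le> t}) - real (card (prime_factors q))
    \<le> real (card (coprime_primes q t))"
proof -
  have "{p::nat. prime p \<and> real p \<le> t} \<subseteq> coprime_primes q t \<union> prime_factors q"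
    using assms unfolding coprime_primes_def
    by (auto simp: prime_factors_dvd prime_imp_coprime)
  then have "card {p::nat. prime p \<and> real p \<le> t} \<le> card (coprime_primes q t \<union> prime_factors q)"
    using finite_coprime_primes by (intro card_mono) auto
  also have "\<dots> \<le> card (coprime_primes q t) + card (prime_factors q)" by (rule card_Un_le)
  finally show ?thesis by linarith
qed

text \<open>Each factor \<open>1 - 1 / p\<close> is at least 1/2, so \<open>q\<close> loses at most
  a power of 2 whose exponent is its number of prime factors; together with the extra 2 this is at
  most \<open>q powr (1/10)\<close>.\<close>

lemma eventually_totient_ge:
  "\<forall>\<^sub>F q::nat in at_top. 2 * real q powr (9/10) \<le> totient q"
proof -
  have "\<forall>\<^sub>F q::nat in at_top. 15/10 * ln (real q) / ln (10 * ln (real q)) + 1 \<le> ln (real q) / 10"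
    by real_asymp
  then show ?thesis using eventually_card_prime_factors_le eventually_gt_at_top[of 0]
  proof eventually_elim
    case (elim q)
    define m where "m = card (prime_factors q)"
    have "real m + 1 \<le> ln (real q) / 10" using elim unfolding m_def by linarith
    have "2 ^ (m + 1) \<le> exp (real (m + 1) * 1)"
      unfolding exp_of_nat_mult using exp_ge_add_one_self[of 1] by (intro power_mono) auto
    also have "\<dots> \<le> exp (ln (real q) / 10)" using \<open>real m + 1 \<le> ln (real q) / 10\<close> by simp
    also have "\<dots> = real q powr (1/10)" using elim by (simp add: powr_def)
    finally have two: "2 ^ (m + 1) \<le> real q powr (1/10)" .
    have "2 * real q powr (9/10) * 2 ^ m = real q powr (9/10) * 2 ^ (m + 1)" by simp
    also have "\<dots> \<le> real q powr (9/10) * real q powr (1/10)" using two by (intro mult_left_mono) auto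
    also have "\<dots> = real q" using elim by (simp flip: powr_add)
    finally have 1: "2 * real q powr (9/10) \<le> real q * (1/2) ^ m"
      by (simp add: power_divide field_simps)
    have "(\<Prod>p\<in>prime_factors q. 1/2) \<le> (\<Prod>p\<in>prime_factors q. 1 - 1 / real p)"
    proof (intro prod_mono conjI)
      fix p assume "p \<in> prime_factors q"
      then have "real p \<ge> 2" using prime_ge_2_nat[of p] by (auto simp: in_prime_factors_iff)
      then show "1/2 \<le> 1 - 1 / real p" by (simp add: field_simps)
    qed simp
    then have "real q * (1/2) ^ m \<le> real (totient q)"
      unfolding totient_formula2 m_def by (simp add: mult_left_mono)
    then show ?case using 1 by linarith
  qed
qed

text \<open>The threshold for \<open>q\<close> must serve all \<open>t\<close> at once, because
  \<open>t\<close> will depend on \<open>B q\<close>. Beyond \<open>e\<close> the quotient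
  \<open>ln t / t\<close> decreases, so the primes dividing \<open>q\<close> cost at most
  \<open>0.15 * t\<close> out of \<open>0.65 * t\<close> for every such \<open>t\<close>.\<close>

lemma eventually_coprime_primes:
  "\<forall>\<^sub>F q::nat in at_top. \<forall>t\<ge>10 * ln q. real (card (coprime_primes q t)) * ln t \<ge> t / 2"
proof -
  obtain t0 where t0: "\<And>t. t \<ge> t0 \<Longrightarrow> real (card {p::nat. prime p \<and> real p \<le> t}) \<ge> 65/100 * t / ln t"
    using eventually_prime_counting unfolding eventually_at_top_linorder by blast
  have "\<forall>\<^sub>F q::nat in at_top. 10 * ln (real q) \<ge> max t0 3" by real_asymp
  then show ?thesis using eventually_card_prime_factors_le eventually_gt_at_top[of 0]
  proof eventually_elim
    case (elim q)
    show ?case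
    proof (intro allI impI)
      fix t assume t: "t \<ge> 10 * ln q"
      define y where "y = 10 * ln (real q)"
      have y: "y \<ge> 3" "y \<ge> t0" "y \<le> t" using elim t unfolding y_def by auto
      have lny: "ln y > 0" "ln t > 0" using y by auto
      have "exp 1 \<le> y" using exp_le y by linarith
      then have "ln t / t \<le> ln y / y" using y by (intro ln_x_over_x_mono)
      then have mono: "y / ln y * ln t \<le> t" using y lny by (simp add: field_simps)
      have "real (card (prime_factors q)) * ln t \<le> 15/100 * y / ln y * ln t"
        using elim lny unfolding y_def by (intro mult_right_mono) auto
      also have "\<dots> \<le> 15/100 * t" using mono by simp
      finally have om: "real (card (prime_factors q)) * ln t \<le> 15/100 * t" .
      have "65/100 * t / ln t * ln t \<le> real (card {p::nat. prime p \<and> real p \<le> t}) * ln t"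
        using t0[of t] y lny by (intro mult_right_mono) auto
      then have "65/100 * t \<le> real (card {p::nat. prime p \<and> real p \<le> t}) * ln t"
        using lny by simp
      moreover have "(real (card {p::nat. prime p \<and> real p \<le> t}) - real (card (prime_factors q))) * ln t
          \<le> real (card (coprime_primes q t)) * ln t"
        using card_coprime_primes_ge[of q t] elim lny by (intro mult_right_mono) auto
      ultimately show "real (card (coprime_primes q t)) * ln t \<ge> t / 2"
        using om by (simp add: left_diff_distrib)
    qed
  qed
qed

text \<open>The prime factors of \<open>q\<close> number at most
  \<open>w * ln q powr (- \<epsilon>)\<close>, negligible against \<open>w / ln w\<close>. As
  \<open>B \<ge> 1\<close> gives \<open>B / (B + 1) \<ge> 1/2\<close>, \<open>w\<close> is at least
  the square root of \<open>10 * ln q\<close>, so the threshold for \<open>q\<close> is uniform in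
  \<open>B\<close> and \<open>w\<close>.\<close>

lemma eventually_coprime_primes_sparse:
  assumes "\<epsilon> > 0"
  shows "\<forall>\<^sub>F q::nat in at_top. \<forall>B w. B \<ge> 1 \<longrightarrow> (10 * ln q) powr (B / (B + 1)) \<le> w \<longrightarrow> w \<le> 10 * ln q \<longrightarrow>
    real (card (prime_factors q)) < ln q powr (B / (B + 1) - \<epsilon>) \<longrightarrow>
    real (card (coprime_primes q w)) * ln w \<ge> w / 2"
proof -
  obtain t0 where t0: "\<And>t. t \<ge> t0 \<Longrightarrow> real (card {p::nat. prime p \<and> real p \<le> t}) \<ge> 65/100 * t / ln t"
    using eventually_prime_counting unfolding eventually_at_top_linorder by blast
  have "\<forall>\<^sub>F q::nat in at_top. (10 * ln (real q)) powr (1/2) \<ge> max t0 3" by real_asymp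
  moreover have "\<forall>\<^sub>F q::nat in at_top. ln (real q) powr (- \<epsilon>) * ln (10 * ln (real q)) \<le> 15/100"
    using assms by real_asymp
  moreover have "\<forall>\<^sub>F q::nat in at_top. ln (real q) \<ge> 1" by real_asymp
  ultimately show ?thesis using eventually_gt_at_top[of 0]
  proof eventually_elim
    case (elim q)
    define L where "L = ln (real q)"
    show ?case
      unfolding L_def[symmetric]
    proof (intro allI impI)
      fix B w :: real
      assume B: "B \<ge> 1" and w: "(10 * L) powr (B / (B + 1)) \<le> w" "w \<le> 10 * L"
        and om: "real (card (prime_factors q)) < L powr (B / (B + 1) - \<epsilon>)"
      have L: "L \<ge> 1" using elim unfolding L_def by simp
      have "(10 * L) powr (1/2) \<le> (10 * L) powr (B / (B + 1))"
        using B L by (intro powr_mono) (auto simp: field_simps)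
      moreover have "3 \<le> (10 * L) powr (1/2)" "t0 \<le> (10 * L) powr (1/2)"
        using elim unfolding L_def by auto
      ultimately have w3: "w \<ge> 3" "w \<ge> t0" using w by linarith+
      have lnw: "ln w > 0" using w3 by simp
      have "L powr (B / (B + 1)) \<le> (10 * L) powr (B / (B + 1))"
        using B L by (intro powr_mono2) auto
      then have "L powr (B / (B + 1)) * L powr (- \<epsilon>) \<le> w * L powr (- \<epsilon>)"
        using w by (intro mult_right_mono) auto
      then have "real (card (prime_factors q)) \<le> w * L powr (- \<epsilon>)"
        using om by (simp flip: powr_add)
      then have "real (card (prime_factors q)) * ln w \<le> (w * L powr (- \<epsilon>)) * ln (10 * L)"
        using w w3 lnw by (intro mult_mono) auto
      also have "\<dots> \<le> w * (15/100)"
        using elim w3 unfolding L_def by (simp only: mult.assoc) (intro mult_left_mono; simp)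
      finally have om': "real (card (prime_factors q)) * ln w \<le> 15/100 * w" by simp
      have "65/100 * w / ln w * ln w \<le> real (card {p::nat. prime p \<and> real p \<le> w}) * ln w"
        using t0[of w] w3 lnw by (intro mult_right_mono) auto
      then have "65/100 * w \<le> real (card {p::nat. prime p \<and> real p \<le> w}) * ln w"
        using lnw by simp
      moreover have "(real (card {p::nat. prime p \<and> real p \<le> w}) - real (card (prime_factors q))) * ln w
          \<le> real (card (coprime_primes q w)) * ln w"
        using card_coprime_primes_ge[of q w] elim lnw by (intro mult_right_mono) auto
      ultimately show "real (card (coprime_primes q w)) * ln w \<ge> w / 2"
        using om' by (simp add: left_diff_distrib)
    qed
  qed
qed

section \<open>Choice of the parameters and the two bounds\<close>

lemma eventually_ln_le:
  assumes "\<delta> \<longlonglongrightarrow> 0" "\<forall>\<^sub>F q::nat in at_top. x q = real q powr \<delta> q"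
  shows "\<forall>\<^sub>F q::nat in at_top. ln (x q) \<le> ln (real q) / 10"
proof -
  have "\<forall>\<^sub>F q in at_top. \<delta> q < 1/10" using assms(1) by (rule order_tendstoD) simp
  then show ?thesis using assms(2) eventually_gt_at_top[of 1]
  proof eventually_elim
    case (elim q)
    then have "ln (x q) = \<delta> q * ln (real q)" by (simp add: ln_powr)
    also have "\<dots> \<le> 1/10 * ln (real q)" using elim by (intro mult_right_mono) auto
    finally show ?case by simp
  qed
qed

text \<open>Take \<open>w = y\<close>, \<open>a = b - 1\<close> and let
  \<open>Y = y powr (B - a)\<close> absorb the fractional part of \<open>B\<close>; it is at least
  \<open>y\<close> because \<open>B - a \<ge> 1\<close>. The exponents add up to
  \<open>2 * a + 1 + (B - a) = B + b\<close>.\<close>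

lemma max_character_sum_ge_general:
  fixes B x :: real and q :: nat
  defines "y \<equiv> 10 * ln q" and "b \<equiv> nat \<lfloor>B\<rfloor>"
  assumes q: "2 * real q powr (9/10) \<le> totient q" and y: "y > 1"
    and primes: "\<And>t. t \<ge> y \<Longrightarrow> real (card (coprime_primes q t)) * ln t \<ge> t / 2"
    and B: "B \<ge> 1" and x: "x = y powr B" "ln x \<le> ln q / 10"
  shows "max_character_sum q x \<ge> large_sum_const * (x powr (1/2 + of_int \<lfloor>B\<rfloor> / (2 * B)) / (4 * ln x) ^ b)"
proof -
  define a where "a = b - 1"
  have b: "b \<ge> 1" "real b \<le> B" "real_of_int \<lfloor>B\<rfloor> = real b" using B unfolding b_def by linarith+
  then have a: "b = Suc a" "real a = real b - 1" unfolding a_def by auto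
  define Y where "Y = y powr (B - real a)"
  have "x > 1" unfolding x using y B by (simp add: gr_one_powr)
  have "y powr 1 \<le> Y" unfolding Y_def using y a b by (intro powr_mono) auto
  then have yY: "y \<le> Y" using y by simp
  have pow: "y ^ n * Y = y powr (real n + (B - real a))" for n
    unfolding Y_def using y by (simp add: powr_add powr_realpow)
  have "y ^ a * Y = x" unfolding pow x by simp
  then have "max_character_sum q x \<ge> large_sum_const * (sqrt (y ^ (2 * a + 1) * Y) / (4 * ln x) ^ Suc a)"
    using q \<open>x > 1\<close> x(2) y yY primes[of y] primes[of Y]
    by (intro max_character_sum_ge) (auto simp: y_def)
  moreover have "sqrt (y ^ (2 * a + 1) * Y) = y powr ((B + real b) / 2)"
    unfolding pow using y a by (simp add: powr_half_sqrt[symmetric] powr_powr add.commute)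
  moreover have "B * (1/2 + real b / (2 * B)) = (B + real b) / 2"
    using B by (simp add: divide_simps)
  then have "x powr (1/2 + of_int \<lfloor>B\<rfloor> / (2 * B)) = y powr ((B + real b) / 2)"
    unfolding x(1) powr_powr b(3) by (simp only:)
  ultimately show ?thesis unfolding a(1) by (simp only:)
qed

text \<open>All \<open>b + 1\<close> primes share the range up to
  \<open>w = y powr (B / (b + 1))\<close>. From \<open>b \<le> B \<le> b + 1\<close> it lies between
  \<open>y powr (B / (B + 1))\<close> and \<open>y\<close>, which explains the exponent in the
  hypothesis on prime factors.\<close>

lemma max_character_sum_ge_sparse:
  fixes B x :: real and q :: nat
  defines "y \<equiv> 10 * ln q" and "b \<equiv> nat \<lfloor>B\<rfloor>"
  assumes q: "2 * real q powr (9/10) \<le> totient q" and y: "y > 1"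
    and primes: "\<And>w. y powr (B / (B + 1)) \<le> w \<Longrightarrow> w \<le> y \<Longrightarrow>
      real (card (coprime_primes q w)) * ln w \<ge> w / 2"
    and B: "B \<ge> 1" and x: "x = y powr B" "ln x \<le> ln q / 10"
  shows "max_character_sum q x \<ge> large_sum_const * (x / (4 * ln x) ^ (b + 1))"
proof -
  have b: "real b \<le> B" "B \<le> real b + 1" using B unfolding b_def by linarith+
  define w where "w = y powr (B / (real b + 1))"
  have "x > 1" unfolding x using y B by (simp add: gr_one_powr)
  have "y powr (B / (real b + 1)) \<le> y powr 1"
    using y b by (intro powr_mono) auto
  then have wy: "w \<le> y" unfolding w_def using y by simp
  have "y powr (B / (B + 1)) \<le> w"
    unfolding w_def using y b B by (intro powr_mono divide_left_mono) auto
  then have pw: "real (card (coprime_primes q w)) * ln w \<ge> w / 2" using wy by (rule primes)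
  have w1: "1 \<le> w" unfolding w_def using y B by (intro ge_one_powr_ge_zero) auto
  have pow: "w ^ Suc b = x"
  proof -
    have "w ^ Suc b = w powr real (Suc b)" using w1 by (subst powr_realpow) auto
    also have "\<dots> = y powr (B / (real b + 1) * real (Suc b))" unfolding w_def by (rule powr_powr)
    also have "B / (real b + 1) * real (Suc b) = B" by (simp add: field_simps)
    finally show ?thesis unfolding x .
  qed
  then have "w ^ b * w = x" by (simp add: mult.commute)
  then have "max_character_sum q x \<ge> large_sum_const * (sqrt (w ^ (2 * b + 1) * w) / (4 * ln x) ^ Suc b)"
    using q \<open>x > 1\<close> x(2) w1 wy pw
    by (intro max_character_sum_ge) (auto simp: y_def)
  moreover have "w ^ (2 * b + 1) * w = x\<^sup>2"
    unfolding pow[symmetric] by (simp add: power2_eq_square power_mult power_add mult_ac flip: power_mult_distrib)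
  ultimately show ?thesis using \<open>x > 1\<close> by simp
qed

theorem theorem4:
  "(\<exists>c>0. \<forall>(B :: nat \<Rightarrow> real) (x :: nat \<Rightarrow> real) (\<delta> :: nat \<Rightarrow> real).
      (\<forall>\<^sub>F q in at_top. B q \<ge> 1 \<and> x q = (10 * ln (real q)) powr B q) \<longrightarrow>
      (\<delta> \<longlonglongrightarrow> 0) \<and> (\<forall>\<^sub>F q in at_top. x q = real q powr \<delta> q) \<longrightarrow>
      (\<forall>\<^sub>F q in at_top.
         max_character_sum q (x q)
           \<ge> c * (x q powr (1/2 + of_int \<lfloor>B q\<rfloor> / (2 * B q)) / (4 * ln (x q)) ^ nat \<lfloor>B q\<rfloor>)))
   \<and>
   (\<forall>\<epsilon>>0. \<exists>c>0. \<forall>(B :: nat \<Rightarrow> real) (x :: nat \<Rightarrow> real) (\<delta> :: nat \<Rightarrow> real).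
      (\<forall>\<^sub>F q in at_top. B q \<ge> 1 \<and> x q = (10 * ln (real q)) powr B q) \<longrightarrow>
      (\<delta> \<longlonglongrightarrow> 0) \<and> (\<forall>\<^sub>F q in at_top. x q = real q powr \<delta> q) \<longrightarrow>
      (\<forall>\<^sub>F q in at_top.
         real (card (prime_factors q)) < ln (real q) powr (B q / (B q + 1) - \<epsilon>) \<longrightarrow>
         max_character_sum q (x q) \<ge> c * (x q / (4 * ln (x q)) ^ (nat \<lfloor>B q\<rfloor> + 1))))"
\<comment> \<open>One constant serves both parts: \<epsilon> affects only how large \<open>q\<close>
  has to be.\<close>
proof (intro conjI allI impI exI[of _ large_sum_const])
  have y: "\<forall>\<^sub>F q::nat in at_top. 10 * ln (real q) > 1" by real_asymp
  fix B x \<delta> :: "nat \<Rightarrow> real"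
  assume Bx: "\<forall>\<^sub>F q in at_top. B q \<ge> 1 \<and> x q = (10 * ln (real q)) powr B q"
    and \<delta>: "(\<delta> \<longlonglongrightarrow> 0) \<and> (\<forall>\<^sub>F q in at_top. x q = real q powr \<delta> q)"
  have small: "\<forall>\<^sub>F q in at_top. ln (x q) \<le> ln (real q) / 10" using \<delta> eventually_ln_le by blast
  show "\<forall>\<^sub>F q in at_top. max_character_sum q (x q)
      \<ge> large_sum_const * (x q powr (1/2 + of_int \<lfloor>B q\<rfloor> / (2 * B q)) / (4 * ln (x q)) ^ nat \<lfloor>B q\<rfloor>)"
    using Bx small y eventually_totient_ge eventually_coprime_primes
    by eventually_elim (intro max_character_sum_ge_general; blast)
  fix \<epsilon> :: real
  assume "\<epsilon> > 0"
  show "\<forall>\<^sub>F q in at_top.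
      real (card (prime_factors q)) < ln (real q) powr (B q / (B q + 1) - \<epsilon>) \<longrightarrow>
      max_character_sum q (x q) \<ge> large_sum_const * (x q / (4 * ln (x q)) ^ (nat \<lfloor>B q\<rfloor> + 1))"
    using Bx small y eventually_totient_ge eventually_coprime_primes_sparse[OF \<open>\<epsilon> > 0\<close>]
    by eventually_elim (intro impI max_character_sum_ge_sparse; blast)
qed (rule large_sum_const_pos)+

end
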